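(* Let $R$ be a ring which is free as a $\mathbb{Z}$-module and let $U,V\in R$. Then, in $\mathcal{G}_\infty^{\mathbb{Z}}(R)[[u,v]]$, $$E_U(u)\,E_{VU}(-uv)^{-1}\,E_V(v)=E_V(v)\,E_{UV}(-uv)^{-1}\,E_U(u).$$
   Context: Rings are associative with unit. $\mathcal{G}_\infty^{\mathbb{Q}}(R)=\bigotimes_{i\ge 1}U(\mathbb{Q}\otimes_{\mathbb{Z}}R_i)$, where each $R_i$ is a copy of $R$, $\mathbb{Q}\otimes R$ is viewed as a Lie algebra via the commutator, $U(-)$ is the universal enveloping algebra, and the infinite tensor product is spanned by pure tensors with all but finitely many factors equal to $1$. For $r\in\mathbb{Q}\otimes R$, $T_i(r)$ is the image of $r$ under the canonical map $\mathbb{Q}\otimes R\to U(\mathbb{Q}\otimes R_i)\subset\mathcal{G}_\infty^{\mathbb{Q}}(R)$. $\Lambda$ is the ring of symmetric functions over $\mathbb{Z}$, with power sums $p_n$ and Schur functions $s_\lambda$. Let $I$ be a $\mathbb{Z}$-basis of $R$. For each $U\in I$, $\Lambda^{(U)}$ is a copy of $\Lambda$ with variable set $\mathbf{x}_U$, and $f^{(U)}=f(\mathbf{x}_U)$. $\mathcal{P}$ is the set of partitions; $\mathcal{P}^I$ is the set of functions $\vec\lambda:I\to\mathcal{P}$ with $\sum_{U}|\vec\lambda(U)|<\infty$. For a $\mathbb{Q}$-algebra $A$ one works with (possibly infinite) formal sums $\sum_{\vec\mu\in\mathcal{P}^I}\left(\prod_U p_{\vec\mu(U)}^{(U)}\right)a_{\vec\mu}$,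 $a_{\vec\mu}\in A$, and $T_l$ is applied coefficientwise to such series with coefficients in $\mathbb{Q}\otimes R$. The elements $Z_{\vec\lambda}\in\mathcal{G}_\infty^{\mathbb{Q}}(R)$ are defined by $$\sum_{\vec\lambda\in\mathcal{P}^I}\Big(\prod_{U\in I}s_{\vec\lambda(U)}^{(U)}\Big)\otimes Z_{\vec\lambda}=\prod_{l=1}^\infty\exp\Big(T_l\Big(\log\Big(1+\sum_{U\in I}p_l^{(U)}U\Big)\Big)\Big),$$ and $\mathcal{G}_\infty^{\mathbb{Z}}(R)$ is the $\mathbb{Z}$-span of the $Z_{\vec\lambda}$; it is a subring of $\mathcal{G}_\infty^{\mathbb{Q}}(R)$, independent of $I$. For a formal series $x$ with coefficients in $\mathbb{Q}\otimes R$ and constant term $1$, $\Theta_l(x)=\exp(T_l(\log x))$ ($T_l$ applied coefficientwise). For $U\in R$, $$E_U(t)=\sum_{r\ge 0}e_r(U)t^r=\prod_{l\ge 1}\Theta_l(1-(-t)^lU),$$ with $e_0(U)=1$ and all $e_r(U)\in\mathcal{G}_\infty^{\mathbb{Z}}(R)$. *)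

theory Defs
  imports Complex_Main "HOL-Library.Poly_Mapping"
begin

section \<open>Integral linear combinations and rational algebras\<close>

text \<open>
  The ring \<open>R\<close> is a type of sort \<open>{ring, monoid_mult}\<close>: an associative ring with unit, where,
  unlike in the class \<^class>\<open>ring_1\<close>, the zero ring is admitted.
\<close>

definition zscale :: "int \<Rightarrow> 'a \<Rightarrow> 'a::ab_group_add" where
  "zscale k x = (\<Sum>i<nat k. x) - (\<Sum>i<nat (- k). x)"

lemma zscale_eq:
  assumes "int m - int n = k"
  shows "zscale k x = (\<Sum>i<m. x) - (\<Sum>i<n. x)"
proof -
  have add: "(\<Sum>i<a + b. x) = (\<Sum>i<a. x) + (\<Sum>i<b. x)" for a b :: nat
    by (induction b) (simp_all add: algebra_simps)
  show ?thesis
  proof (cases "k \<ge> 0")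
    case True
    then have "m = nat k + n" "nat (- k) = 0" using assms by auto
    then show ?thesis by (simp add: zscale_def add)
  next
    case False
    then have "n = nat (- k) + m" "nat k = 0" using assms by auto
    then show ?thesis by (simp add: zscale_def add)
  qed
qed

global_interpretation zmod: module "zscale :: int \<Rightarrow> 'a \<Rightarrow> 'a::ab_group_add"
  defines zspan = zmod.span and zindependent = "\<lambda>B. \<not> zmod.dependent B"
proof
  fix a b :: int and x y :: 'a
  have add: "(\<Sum>i<m + n. z) = (\<Sum>i<m. z) + (\<Sum>i<n. z)" for m n :: nat and z :: 'a
    by (induction n) (simp_all add: algebra_simps)
  have mul: "(\<Sum>j<n. \<Sum>i<m. z) = (\<Sum>i<m * n. z)" for m n :: nat and z :: 'a
    by (induction n) (simp_all add: algebra_simps add)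
  show "zscale a (x + y) = zscale a x + zscale a y"
    by (simp add: zscale_def sum.distrib)
  have "zscale (a + b) x = (\<Sum>i<nat a + nat b. x) - (\<Sum>i<nat (- a) + nat (- b). x)"
    by (rule zscale_eq) auto
  then show "zscale (a + b) x = zscale a x + zscale b x"
    by (simp add: zscale_def add)
  let ?p = "nat a" and ?n = "nat (- a)" and ?q = "nat b" and ?m = "nat (- b)"
  have a: "int ?p - int ?n = a" and b: "int ?q - int ?m = b" by auto
  have "int (?q * ?p + ?m * ?n) - int (?m * ?p + ?q * ?n)
      = (int ?p - int ?n) * (int ?q - int ?m)"
    by (simp add: algebra_simps del: int_nat_eq)
  then have "int (?q * ?p + ?m * ?n) - int (?m * ?p + ?q * ?n) = a * b"
    unfolding a b .
  from zscale_eq[OF this]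
  have "zscale (a * b) x = (\<Sum>i<?q * ?p + ?m * ?n. x) - (\<Sum>i<?m * ?p + ?q * ?n. x)" .
  then show "zscale a (zscale b x) = zscale (a * b) x"
    by (simp add: zscale_def add sum_subtractf mul)
  show "zscale 1 x = x"
    by (simp add: zscale_def)
qed

definition is_zbasis :: "'a::ab_group_add set \<Rightarrow> bool" where
  "is_zbasis B \<longleftrightarrow> zindependent B \<and> zspan B = UNIV"

class rat_algebra = ring + monoid_mult +
  fixes scaleQ :: "rat \<Rightarrow> 'a \<Rightarrow> 'a"  (infixr "*\<^sub>Q" 75)
  assumes scaleQ_add_right: "a *\<^sub>Q (x + y) = a *\<^sub>Q x + a *\<^sub>Q y"
    and scaleQ_add_left: "(a + b) *\<^sub>Q x = a *\<^sub>Q x + b *\<^sub>Q x"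
    and scaleQ_scaleQ: "a *\<^sub>Q b *\<^sub>Q x = (a * b) *\<^sub>Q x"
    and scaleQ_one: "1 *\<^sub>Q x = x"
    and scaleQ_mult_left: "(a *\<^sub>Q x) * y = a *\<^sub>Q (x * y)"
    and scaleQ_mult_right: "x * (a *\<^sub>Q y) = a *\<^sub>Q (x * y)"


section \<open>Quotients of monoid algebras\<close>

text \<open>
  For a monoid \<open>'m\<close> (written additively) the type \<open>'m \<Rightarrow>\<^sub>0 rat\<close> is the monoid algebra over the
  rationals.  The algebras below are quotients of such algebras by two-sided ideals.
\<close>

inductive_set tsideal :: "'a::ring_1 set \<Rightarrow> 'a set" for S where
  gen: "x \<in> S \<Longrightarrow> x \<in> tsideal S"
| zero: "0 \<in> tsideal S"
| add: "x \<in> tsideal S \<Longrightarrow> y \<in> tsideal S \<Longrightarrow> x + y \<in> tsideal S"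
| mult_left: "x \<in> tsideal S \<Longrightarrow> a * x \<in> tsideal S"
| mult_right: "x \<in> tsideal S \<Longrightarrow> x * a \<in> tsideal S"

lemma tsideal_uminus: "x \<in> tsideal S \<Longrightarrow> - x \<in> tsideal S"
  using tsideal.mult_left[of x S "- 1"] by simp

lemma tsideal_diff: "x \<in> tsideal S \<Longrightarrow> y \<in> tsideal S \<Longrightarrow> x - y \<in> tsideal S"
  using tsideal.add[of x S "- y"] tsideal_uminus[of y S] by simp

lemma tsideal_equivp: "equivp (\<lambda>x y. x - y \<in> tsideal S)"
proof (rule equivpI)
  show "reflp (\<lambda>x y. x - y \<in> tsideal S)"
    by (simp add: reflp_def tsideal.zero)
  show "symp (\<lambda>x y. x - y \<in> tsideal S)"
    by (rule sympI) (metis minus_diff_eq tsideal_uminus)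
  show "transp (\<lambda>x y. x - y \<in> tsideal S)"
    by (rule transpI) (metis diff_add_cancel add_diff_eq tsideal.add)
qed

lemma tsideal_cong:
  fixes x y x' y' :: "'a::ring_1"
  assumes "x - x' \<in> tsideal S" "y - y' \<in> tsideal S"
  shows tsideal_cong_add: "(x + y) - (x' + y') \<in> tsideal S"
    and tsideal_cong_diff: "(x - y) - (x' - y') \<in> tsideal S"
    and tsideal_cong_mult: "x * y - x' * y' \<in> tsideal S"
proof -
  show "(x + y) - (x' + y') \<in> tsideal S"
    using tsideal.add[OF assms] by (simp add: algebra_simps)
  show "(x - y) - (x' - y') \<in> tsideal S"
    using tsideal_diff[OF assms] by (simp add: algebra_simps)
  have "(x - x') * y + x' * (y - y') \<in> tsideal S"
    using assms by (intro tsideal.add tsideal.mult_left tsideal.mult_right)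
  then show "x * y - x' * y' \<in> tsideal S"
    by (simp add: algebra_simps)
qed

lemma tsideal_cong_uminus: "x - x' \<in> tsideal S \<Longrightarrow> - x - (- x') \<in> tsideal S"
  using tsideal_uminus[of "x - x'" S] by simp

lemma single_0_central:
  fixes x :: "'m::monoid_add \<Rightarrow>\<^sub>0 rat"
  shows "x * Poly_Mapping.single 0 c = Poly_Mapping.single 0 c * x"
proof (induction x rule: update_induct)
  case const
  then show ?case by simp
next
  case (update f a b)
  have "Poly_Mapping.update a b f = f + Poly_Mapping.single a b"
    using update by (intro poly_mapping_eqI)
      (auto simp: lookup_add lookup_update lookup_single in_keys_iff when_def)
  then show ?case
    using update by (simp add: distrib_left distrib_right mult_single mult.commute)
qed


definition rscale :: "rat \<Rightarrow> ('m::monoid_add \<Rightarrow>\<^sub>0 rat) \<Rightarrow> ('m \<Rightarrow>\<^sub>0 rat)" where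
  "rscale c x = Poly_Mapping.single 0 c * x"

lemma rscale_simps:
  "rscale c (x + y) = rscale c x + rscale c y"
  "rscale (c + d) x = rscale c x + rscale d x"
  "rscale c (rscale d x) = rscale (c * d) x"
  "rscale 1 x = x"
  "rscale c x * y = rscale c (x * y)"
  "x * rscale c y = rscale c (x * y)"
proof -
  show "x * rscale c y = rscale c (x * y)"
    unfolding rscale_def by (metis mult.assoc single_0_central)
qed (simp_all add: rscale_def distrib_left distrib_right single_add mult_single
       flip: mult.assoc)

lemma tsideal_eqI: "x = y \<Longrightarrow> x - y \<in> tsideal S"
  by (simp add: tsideal.zero)

lemma tsideal_cong_rscale: "x - y \<in> tsideal S \<Longrightarrow> rscale c x - rscale c y \<in> tsideal S"
  unfolding rscale_def by (simp add: tsideal.mult_left flip: right_diff_distrib)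


subsection \<open>The algebra \<open>\<rat> \<otimes> R\<close>\<close>

datatype 'a multmon = Multmon 'a

instantiation multmon :: (monoid_mult) monoid_add
begin
definition "0 = Multmon 1"
fun plus_multmon where "Multmon x + Multmon y = Multmon (x * y)"
instance
proof
  fix a b c :: "'a multmon"
  show "a + b + c = a + (b + c)" by (cases a; cases b; cases c) (simp add: mult.assoc)
  show "0 + a = a" "a + 0 = a" by (cases a; simp add: zero_multmon_def)+
qed
end

text \<open>
  The rational vector space spanned by the symbols \<open>1 \<otimes> r\<close> modulo additivity in \<open>r\<close>;
  the multiplication is \<open>(1 \<otimes> r) * (1 \<otimes> s) = 1 \<otimes> r * s\<close>.
\<close>

definition ratext_rels :: "('r::{ring, monoid_mult} multmon \<Rightarrow>\<^sub>0 rat) set" where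
  "ratext_rels = {Poly_Mapping.single (Multmon (r + s)) 1
      - Poly_Mapping.single (Multmon r) 1 - Poly_Mapping.single (Multmon s) 1 | r s. True}"

quotient_type (overloaded) 'r ratext = "'r::{ring, monoid_mult} multmon \<Rightarrow>\<^sub>0 rat"
  / "\<lambda>x y. x - y \<in> tsideal ratext_rels"
  by (rule tsideal_equivp)

instantiation ratext :: ("{ring, monoid_mult}") rat_algebra
begin
lift_definition zero_ratext :: "'a ratext" is 0 .
lift_definition one_ratext :: "'a ratext" is 1 .
lift_definition plus_ratext :: "'a ratext \<Rightarrow> 'a ratext \<Rightarrow> 'a ratext" is "(+)"
  by (rule tsideal_cong_add)
lift_definition minus_ratext :: "'a ratext \<Rightarrow> 'a ratext \<Rightarrow> 'a ratext" is "(-)"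
  by (rule tsideal_cong_diff)
lift_definition uminus_ratext :: "'a ratext \<Rightarrow> 'a ratext" is uminus
  by (rule tsideal_cong_uminus)
lift_definition times_ratext :: "'a ratext \<Rightarrow> 'a ratext \<Rightarrow> 'a ratext" is "(*)"
  by (rule tsideal_cong_mult)
lift_definition scaleQ_ratext :: "rat \<Rightarrow> 'a ratext \<Rightarrow> 'a ratext"
  is "rscale"
  by (rule tsideal_cong_rscale)
instance
  by standard
    (transfer, rule tsideal_eqI, simp add: algebra_simps rscale_simps)+
end

lift_definition ratext_of :: "'r::{ring, monoid_mult} \<Rightarrow> 'r ratext"
  is "\<lambda>r. Poly_Mapping.single (Multmon r) 1" .


subsection \<open>Universal enveloping algebras\<close>

datatype 'a fword = Fword "'a list"

instantiation fword :: (type) monoid_add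
begin
definition "0 = Fword []"
fun plus_fword where "Fword xs + Fword ys = Fword (xs @ ys)"
instance
proof
  fix a b c :: "'a fword"
  show "a + b + c = a + (b + c)" by (cases a; cases b; cases c) simp
  show "0 + a = a" "a + 0 = a" by (cases a; simp add: zero_fword_def)+
qed
end

definition fgen :: "'a \<Rightarrow> 'a fword \<Rightarrow>\<^sub>0 rat" where
  "fgen x = Poly_Mapping.single (Fword [x]) 1"

text \<open>
  The universal enveloping algebra of an associative algebra regarded as a Lie algebra with the
  commutator bracket: the first two families of relations turn the free algebra on the underlying
  set into the tensor algebra.
\<close>

definition uea_rels :: "('g::rat_algebra fword \<Rightarrow>\<^sub>0 rat) set" where
  "uea_rels =
     {fgen (x + y) - fgen x - fgen y | x y. True} \<union>
     {fgen (c *\<^sub>Q x) - rscale c (fgen x) | c x. True} \<union>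
     {fgen x * fgen y - fgen y * fgen x - fgen (x * y - y * x) | x y. True}"

quotient_type (overloaded) 'g uea = "'g::rat_algebra fword \<Rightarrow>\<^sub>0 rat"
  / "\<lambda>x y. x - y \<in> tsideal uea_rels"
  by (rule tsideal_equivp)

instantiation uea :: (rat_algebra) rat_algebra
begin
lift_definition zero_uea :: "'a uea" is 0 .
lift_definition one_uea :: "'a uea" is 1 .
lift_definition plus_uea :: "'a uea \<Rightarrow> 'a uea \<Rightarrow> 'a uea" is "(+)"
  by (rule tsideal_cong_add)
lift_definition minus_uea :: "'a uea \<Rightarrow> 'a uea \<Rightarrow> 'a uea" is "(-)"
  by (rule tsideal_cong_diff)
lift_definition uminus_uea :: "'a uea \<Rightarrow> 'a uea" is uminus
  by (rule tsideal_cong_uminus)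
lift_definition times_uea :: "'a uea \<Rightarrow> 'a uea \<Rightarrow> 'a uea" is "(*)"
  by (rule tsideal_cong_mult)
lift_definition scaleQ_uea :: "rat \<Rightarrow> 'a uea \<Rightarrow> 'a uea"
  is "rscale"
  by (rule tsideal_cong_rscale)
instance
  by standard
    (transfer, rule tsideal_eqI, simp add: algebra_simps rscale_simps)+
end

lift_definition uea_of :: "'g::rat_algebra \<Rightarrow> 'g uea" is fgen .


subsection \<open>Infinite tensor powers\<close>

text \<open>
  Pure tensors of the tensor product of copies of \<open>A\<close> indexed by the positive integers;
  the unused index \<open>0\<close> always carries the entry \<open>1\<close>.  The tensor product is the algebra of this
  monoid modulo multilinearity in each position \<open>i \<ge> 1\<close>.
\<close>

typedef (overloaded) 'a pure =
  "{f :: nat \<Rightarrow> 'a::monoid_mult. f 0 = 1 \<and> finite {i. f i \<noteq> 1}}"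
  by (rule exI[of _ "\<lambda>_. 1"]) simp

setup_lifting type_definition_pure

instantiation pure :: (monoid_mult) monoid_add
begin
lift_definition zero_pure :: "'a pure" is "\<lambda>_. 1" by simp
lift_definition plus_pure :: "'a pure \<Rightarrow> 'a pure \<Rightarrow> 'a pure" is "\<lambda>f g i. f i * g i"
proof -
  fix f g :: "nat \<Rightarrow> 'a"
  assume "f 0 = 1 \<and> finite {i. f i \<noteq> 1}" "g 0 = 1 \<and> finite {i. g i \<noteq> 1}"
  moreover have "{i. f i * g i \<noteq> 1} \<subseteq> {i. f i \<noteq> 1} \<union> {i. g i \<noteq> 1}" by auto
  ultimately show "f 0 * g 0 = 1 \<and> finite {i. f i * g i \<noteq> 1}"
    by (auto intro: finite_subset)
qed
instance
  by standard (transfer, simp add: mult.assoc)+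
end

lift_definition pure_upd :: "'a::monoid_mult pure \<Rightarrow> nat \<Rightarrow> 'a \<Rightarrow> 'a pure"
  is "\<lambda>f i x. if i = 0 then f else f(i := x)"
proof -
  fix f :: "nat \<Rightarrow> 'a" and i x
  assume f: "f 0 = 1 \<and> finite {i. f i \<noteq> 1}"
  have "{j. (f(i := x)) j \<noteq> 1} \<subseteq> insert i {j. f j \<noteq> 1}" by auto
  then have "finite {j. (f(i := x)) j \<noteq> 1}" using f by (metis finite_insert finite_subset)
  then show "(if i = 0 then f else f(i := x)) 0 = 1 \<and>
      finite {j. (if i = 0 then f else f(i := x)) j \<noteq> 1}"
    using f by (cases "i = 0") simp_all
qed

definition itensor_rels :: "('a::rat_algebra pure \<Rightarrow>\<^sub>0 rat) set" where
  "itensor_rels =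
     {Poly_Mapping.single (pure_upd f i (x + y)) 1
       - Poly_Mapping.single (pure_upd f i x) 1
       - Poly_Mapping.single (pure_upd f i y) 1 | f i x y. i \<ge> 1} \<union>
     {Poly_Mapping.single (pure_upd f i (c *\<^sub>Q x)) 1
       - Poly_Mapping.single (pure_upd f i x) c | f i c x. i \<ge> 1}"

quotient_type (overloaded) 'a itensor = "'a::rat_algebra pure \<Rightarrow>\<^sub>0 rat"
  / "\<lambda>x y. x - y \<in> tsideal itensor_rels"
  by (rule tsideal_equivp)

instantiation itensor :: (rat_algebra) rat_algebra
begin
lift_definition zero_itensor :: "'a itensor" is 0 .
lift_definition one_itensor :: "'a itensor" is 1 .
lift_definition plus_itensor :: "'a itensor \<Rightarrow> 'a itensor \<Rightarrow> 'a itensor" is "(+)"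
  by (rule tsideal_cong_add)
lift_definition minus_itensor :: "'a itensor \<Rightarrow> 'a itensor \<Rightarrow> 'a itensor" is "(-)"
  by (rule tsideal_cong_diff)
lift_definition uminus_itensor :: "'a itensor \<Rightarrow> 'a itensor" is uminus
  by (rule tsideal_cong_uminus)
lift_definition times_itensor :: "'a itensor \<Rightarrow> 'a itensor \<Rightarrow> 'a itensor" is "(*)"
  by (rule tsideal_cong_mult)
lift_definition scaleQ_itensor :: "rat \<Rightarrow> 'a itensor \<Rightarrow> 'a itensor"
  is "rscale"
  by (rule tsideal_cong_rscale)
instance
  by standard
    (transfer, rule tsideal_eqI, simp add: algebra_simps rscale_simps)+
end

lift_definition itensor_at :: "nat \<Rightarrow> 'a \<Rightarrow> 'a::rat_algebra itensor"
  is "\<lambda>i x. Poly_Mapping.single (pure_upd 0 i x) 1" .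

type_synonym 'r ginf = "'r ratext uea itensor"

definition T :: "nat \<Rightarrow> 'r::{ring, monoid_mult} ratext \<Rightarrow> 'r ginf" where
  "T i x = itensor_at i (uea_of x)"


section \<open>Formal power series in arbitrarily many variables\<close>

text \<open>
  The variables are the elements of \<open>'v\<close>; they commute with each other and with the coefficients,
  which need not commute among themselves.
\<close>

typedef ('v, 'a) mps = "UNIV :: (('v \<Rightarrow>\<^sub>0 nat) \<Rightarrow> 'a) set"
  morphisms mps_nth Abs_mps ..

setup_lifting type_definition_mps

lemma mps_eqI: "(\<And>m. mps_nth f m = mps_nth g m) \<Longrightarrow> f = g"
  by (metis ext mps_nth_inject)

definition splittings :: "('v \<Rightarrow>\<^sub>0 nat) \<Rightarrow> (('v \<Rightarrow>\<^sub>0 nat) \<times> ('v \<Rightarrow>\<^sub>0 nat)) set" where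
  "splittings m = {(a, b). a + b = m}"

lemma finite_splittings: "finite (splittings m)"
proof -
  let ?look = "Poly_Mapping.lookup :: ('a \<Rightarrow>\<^sub>0 nat) \<Rightarrow> 'a \<Rightarrow> nat"
  define K where "K = {x. ?look m x \<noteq> 0}"
  define N where "N = Max (insert 0 (?look m ` K))"
  define F where "F = {f. \<forall>x. (x \<in> K \<longrightarrow> f x \<in> {..N}) \<and> (x \<notin> K \<longrightarrow> f x = (0::nat))}"
  have "finite K"
    unfolding K_def by (rule finite_lookup)
  then have fin: "finite F"
    unfolding F_def by (intro finite_set_of_finite_funs) auto
  have N: "?look m x \<le> N" if "x \<in> K" for x
    unfolding N_def using that \<open>finite K\<close> by (intro Max_ge) auto
  have F: "?look a \<in> F" if le: "\<And>x. ?look a x \<le> ?look m x" for a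
  proof -
    have "?look a x \<le> N" if "x \<in> K" for x
      using le[of x] N[OF that] by linarith
    moreover have "?look a x = 0" if "x \<notin> K" for x
      using le[of x] that by (simp add: K_def)
    ultimately show ?thesis by (simp add: F_def)
  qed
  define A where "A = {a. \<forall>x. ?look a x \<le> ?look m x}"
  have "?look ` A \<subseteq> F"
    using F by (auto simp: A_def)
  then have "finite (?look ` A)"
    using fin finite_subset by blast
  then have "finite A"
    by (rule finite_imageD) (simp add: inj_on_def)
  moreover have "splittings m \<subseteq> A \<times> A"
    by (auto simp: splittings_def A_def lookup_add)
  ultimately show ?thesis
    by (meson finite_SigmaI finite_subset)
qed

instantiation mps :: (type, zero) zero
begin
lift_definition zero_mps :: "('a, 'b) mps" is "\<lambda>_. 0" .
instance ..
end

instantiation mps :: (type, "{zero, one}") one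
begin
lift_definition one_mps :: "('a, 'b) mps" is "\<lambda>m. if m = 0 then 1 else 0" .
instance ..
end

instantiation mps :: (type, plus) plus
begin
lift_definition plus_mps :: "('a, 'b) mps \<Rightarrow> ('a, 'b) mps \<Rightarrow> ('a, 'b) mps"
  is "\<lambda>f g m. f m + g m" .
instance ..
end

instantiation mps :: (type, minus) minus
begin
lift_definition minus_mps :: "('a, 'b) mps \<Rightarrow> ('a, 'b) mps \<Rightarrow> ('a, 'b) mps"
  is "\<lambda>f g m. f m - g m" .
instance ..
end

instantiation mps :: (type, uminus) uminus
begin
lift_definition uminus_mps :: "('a, 'b) mps \<Rightarrow> ('a, 'b) mps" is "\<lambda>f m. - f m" .
instance ..
end

instantiation mps :: (type, "{comm_monoid_add, times}") times
begin
lift_definition times_mps :: "('a, 'b) mps \<Rightarrow> ('a, 'b) mps \<Rightarrow> ('a, 'b) mps"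
  is "\<lambda>f g m. \<Sum>(a, b)\<in>splittings m. f a * g b" .
instance ..
end

lemmas mps_nth_simps =
  zero_mps.rep_eq one_mps.rep_eq plus_mps.rep_eq minus_mps.rep_eq uminus_mps.rep_eq
  times_mps.rep_eq

instance mps :: (type, ab_group_add) ab_group_add
  by standard (auto intro!: mps_eqI simp: mps_nth_simps algebra_simps)

instance mps :: (type, ring) ring
proof
  fix f g h :: "('a, 'b) mps"
  show "(f + g) * h = f * h + g * h" "f * (g + h) = f * g + f * h"
    by (auto intro!: mps_eqI simp: mps_nth_simps algebra_simps sum.distrib case_prod_unfold)
  show "f * g * h = f * (g * h)"
  proof (rule mps_eqI)
    fix m :: "'a \<Rightarrow>\<^sub>0 nat"
    let ?L = "SIGMA p:splittings m. splittings (fst p)"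
    let ?R = "SIGMA p:splittings m. splittings (snd p)"
    have "mps_nth (f * g * h) m =
        (\<Sum>p\<in>splittings m. \<Sum>q\<in>splittings (fst p).
          mps_nth f (fst q) * mps_nth g (snd q) * mps_nth h (snd p))"
      by (simp add: mps_nth_simps case_prod_unfold sum_distrib_right)
    also have "\<dots> = (\<Sum>(p, q)\<in>?L.
          mps_nth f (fst q) * mps_nth g (snd q) * mps_nth h (snd p))"
      by (rule sum.Sigma) (auto simp: finite_splittings)
    also have "\<dots> = (\<Sum>(p, q)\<in>?R.
          mps_nth f (fst p) * mps_nth g (fst q) * mps_nth h (snd q))"
      by (rule sum.reindex_bij_witness
            [where j = "\<lambda>((a, b), (c, d)). ((c, d + b), (d, b))"
               and i = "\<lambda>((a, b), (c, d)). ((a + c, d), (a, c))"])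
         (auto simp: splittings_def add.assoc)
    also have "\<dots> = (\<Sum>p\<in>splittings m. \<Sum>q\<in>splittings (snd p).
          mps_nth f (fst p) * mps_nth g (fst q) * mps_nth h (snd q))"
      by (rule sum.Sigma[symmetric]) (auto simp: finite_splittings)
    also have "\<dots> = mps_nth (f * (g * h)) m"
      by (simp add: mps_nth_simps case_prod_unfold sum_distrib_left mult.assoc)
    finally show "mps_nth (f * g * h) m = mps_nth (f * (g * h)) m" .
  qed
qed

instance mps :: (type, "{ring, monoid_mult}") monoid_mult
proof
  fix f :: "('a, 'b) mps"
  show "1 * f = f"
  proof (rule mps_eqI)
    fix m :: "'a \<Rightarrow>\<^sub>0 nat"
    have "mps_nth (1 * f) m = (\<Sum>p\<in>{(0, m)}. mps_nth (1 :: ('a, 'b) mps) (fst p) * mps_nth f (snd p))"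
      unfolding times_mps.rep_eq case_prod_unfold
      by (rule sum.mono_neutral_right)
         (auto simp: finite_splittings, auto simp: splittings_def mps_nth_simps split: if_splits)
    then show "mps_nth (1 * f) m = mps_nth f m" by (simp add: mps_nth_simps)
  qed
  show "f * 1 = f"
  proof (rule mps_eqI)
    fix m :: "'a \<Rightarrow>\<^sub>0 nat"
    have "mps_nth (f * 1) m = (\<Sum>p\<in>{(m, 0)}. mps_nth f (fst p) * mps_nth (1 :: ('a, 'b) mps) (snd p))"
      unfolding times_mps.rep_eq case_prod_unfold
      by (rule sum.mono_neutral_right)
         (auto simp: finite_splittings, auto simp: splittings_def mps_nth_simps split: if_splits)
    then show "mps_nth (f * 1) m = mps_nth f m" by (simp add: mps_nth_simps)
  qed
qed

instance mps :: (type, comm_ring_1) comm_ring_1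
proof
  fix f g :: "('a, 'b) mps"
  show "f * g = g * f"
  proof (rule mps_eqI)
    fix m :: "'a \<Rightarrow>\<^sub>0 nat"
    show "mps_nth (f * g) m = mps_nth (g * f) m"
      unfolding times_mps.rep_eq
      by (rule sum.reindex_bij_witness[where i = prod.swap and j = prod.swap])
         (auto simp: splittings_def add.commute mult.commute)
  qed
  show "1 * f = f" by (rule mult_1_left)
  show "(0 :: ('a, 'b) mps) \<noteq> 1"
    by (metis one_mps.rep_eq zero_mps.rep_eq zero_neq_one)
qed (simp_all add: algebra_simps)

definition mps_monom :: "('v \<Rightarrow>\<^sub>0 nat) \<Rightarrow> 'a \<Rightarrow> ('v, 'a::zero) mps" where
  "mps_monom m a = Abs_mps (\<lambda>k. if k = m then a else 0)"

definition mps_var :: "'v \<Rightarrow> ('v, 'a::{zero, one}) mps" where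
  "mps_var v = mps_monom (Poly_Mapping.single v 1) 1"

definition mps_map :: "('a \<Rightarrow> 'b) \<Rightarrow> ('v, 'a) mps \<Rightarrow> ('v, 'b) mps" where
  "mps_map h f = Abs_mps (\<lambda>m. h (mps_nth f m))"

text \<open>
  In the next three definitions \<^const>\<open>Sum_any\<close> is the sum of a family with only finitely many
  nonzero members. The series \<open>X\<close>, \<open>F - 1\<close> and \<open>s\<close> are meant to have constant term \<open>0\<close>, so that
  only finitely many of their powers contribute to a given coefficient.
\<close>

definition mps_exp :: "('v, 'a::rat_algebra) mps \<Rightarrow> ('v, 'a) mps" where
  "mps_exp X = Abs_mps (\<lambda>m. Sum_any (\<lambda>n. (1 / fact n) *\<^sub>Q mps_nth (X ^ n) m))"

definition mps_log :: "('v, 'a::rat_algebra) mps \<Rightarrow> ('v, 'a) mps" where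
  "mps_log F = Abs_mps (\<lambda>m. Sum_any (\<lambda>n.
     ((- 1) ^ n / of_nat (Suc n)) *\<^sub>Q mps_nth ((F - 1) ^ Suc n) m))"

text \<open>Substitution of a series \<open>s\<close> with rational coefficients for the variable of \<open>f\<close>.\<close>

definition mps_subst :: "(unit, 'a::rat_algebra) mps \<Rightarrow> ('v, rat) mps \<Rightarrow> ('v, 'a) mps" where
  "mps_subst f s = Abs_mps (\<lambda>m. Sum_any (\<lambda>r.
     mps_nth (s ^ r) m *\<^sub>Q mps_nth f (Poly_Mapping.single () r)))"

definition mps_inverse :: "('v, 'a::{ring, monoid_mult}) mps \<Rightarrow> ('v, 'a) mps" where
  "mps_inverse f = (THE g. f * g = 1 \<and> g * f = 1)"

text \<open>
  The ordered product \<open>F 1 * F 2 * F 3 * \<dots>\<close>, meant for factors such that each coefficient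
  of the partial products is eventually constant.
\<close>

definition mps_infprod :: "(nat \<Rightarrow> ('v, 'a::{ring, monoid_mult}) mps) \<Rightarrow> ('v, 'a) mps" where
  "mps_infprod F = Abs_mps (\<lambda>m. THE c.
     \<forall>\<^sub>F L in sequentially. mps_nth (prod_list (map F [1..<Suc L])) m = c)"

definition mps_over :: "'a set \<Rightarrow> ('v, 'a) mps set" where
  "mps_over S = {f. \<forall>m. mps_nth f m \<in> S}"


section \<open>The elements \<open>e\<^sub>r(U)\<close>\<close>

definition Theta ::
  "nat \<Rightarrow> ('v, 'r::{ring, monoid_mult} ratext) mps \<Rightarrow> ('v, 'r ginf) mps" where
  "Theta l F = mps_exp (mps_map (T l) (mps_log F))"

definition Eseries :: "'r::{ring, monoid_mult} \<Rightarrow> (unit, 'r ginf) mps" where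
  "Eseries U = mps_infprod (\<lambda>l.
     Theta l (1 - mps_monom (Poly_Mapping.single () l) ((- 1) ^ l *\<^sub>Q ratext_of U)))"


section \<open>The integral form\<close>

text \<open>
  The symmetric functions of the variable set of \<open>U\<close> are realized as power series in the
  variables \<open>(U, i)\<close>, \<open>i = 0, 1, 2, \<dots>\<close>.  Partitions are weakly decreasing lists of positive
  integers, and a tableau is the list of its rows.
\<close>

definition psum :: "'r \<Rightarrow> nat \<Rightarrow> ('r \<times> nat, int) mps" where
  "psum U l = Abs_mps (\<lambda>m. if \<exists>i. m = Poly_Mapping.single (U, i) l then 1 else 0)"

definition is_partition :: "nat list \<Rightarrow> bool" where
  "is_partition \<mu> \<longleftrightarrow> sorted_wrt (\<ge>) \<mu> \<and> 0 \<notin> set \<mu>"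

definition ssyt :: "nat list \<Rightarrow> nat list list set" where
  "ssyt \<mu> = {t. map length t = \<mu> \<and> (\<forall>row \<in> set t. sorted row) \<and>
     (\<forall>i j. Suc i < length t \<and> j < length (t ! Suc i) \<longrightarrow> t ! i ! j < t ! Suc i ! j)}"

definition schur :: "'r \<Rightarrow> nat list \<Rightarrow> ('r \<times> nat, int) mps" where
  "schur U \<mu> = Abs_mps (\<lambda>m. int (card {t \<in> ssyt \<mu>.
     \<forall>W i. Poly_Mapping.lookup m (W, i) = (if W = U then count_list (concat t) i else 0)}))"

text \<open>
  A function from the basis \<open>B\<close> to partitions of finite total size is extended by the empty
  partition outside \<open>B\<close>.
\<close>

definition mpartitions :: "'r set \<Rightarrow> ('r \<Rightarrow> nat list) set" where
  "mpartitions B = {\<Lambda>. (\<forall>U. is_partition (\<Lambda> U)) \<and> {U. \<Lambda> U \<noteq> []} \<subseteq> B \<and> finite {U. \<Lambda> U \<noteq> []}}"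

definition mschur :: "('r \<Rightarrow> nat list) \<Rightarrow> ('r \<times> nat, int) mps" where
  "mschur \<Lambda> = (\<Prod>U\<in>{U. \<Lambda> U \<noteq> []}. schur U (\<Lambda> U))"

text \<open>The series \<open>1 + \<Sum>\<^bsub>U \<in> B\<^esub> p\<^sub>l\<^sup>(\<^sup>U\<^sup>) U\<close>.\<close>

definition basis_series ::
  "'r::{ring, monoid_mult} set \<Rightarrow> nat \<Rightarrow> ('r \<times> nat, 'r ratext) mps" where
  "basis_series B l = 1 + Abs_mps (\<lambda>m.
     \<Sum>U | U \<in> B \<and> mps_nth (psum U l) m \<noteq> 0. zscale (mps_nth (psum U l) m) (ratext_of U))"

text \<open>The defining identity of the family of the \<open>Z\<^sub>\<Lambda>\<close>, compared coefficientwise.\<close>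

definition is_Z_family ::
  "'r::{ring, monoid_mult} set \<Rightarrow> (('r \<Rightarrow> nat list) \<Rightarrow> 'r ginf) \<Rightarrow> bool" where
  "is_Z_family B Z \<longleftrightarrow>
     Abs_mps (\<lambda>m. \<Sum>\<Lambda> | \<Lambda> \<in> mpartitions B \<and> mps_nth (mschur \<Lambda>) m \<noteq> 0.
       zscale (mps_nth (mschur \<Lambda>) m) (Z \<Lambda>))
     = mps_infprod (\<lambda>l. Theta l (basis_series B l))"

definition G_int ::
  "'r::{ring, monoid_mult} set \<Rightarrow> (('r \<Rightarrow> nat list) \<Rightarrow> 'r ginf) \<Rightarrow> 'r ginf set" where
  "G_int B Z = zspan (Z ` mpartitions B)"

datatype uv = Var_u | Var_v

abbreviation u_var :: "(uv, rat) mps" where "u_var \<equiv> mps_var Var_u"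
abbreviation v_var :: "(uv, rat) mps" where "v_var \<equiv> mps_var Var_v"

end

theory Submission
  imports Defs "HOL-Computational_Algebra.Formal_Power_Series"
begin

text \<open>
  For a series \<open>f\<close> over \<open>R\<close> with constant term \<open>1\<close> let \<open>\<psi>\<^sub>l f\<close> be obtained from it by
  \<open>x\<^sup>m r \<mapsto> (- 1)\<^bsup>l \<bar>m\<bar>\<^esup> x\<^bsup>l m\<^esup> r\<close>, which is multiplicative, and let
  \<open>M f = \<Prod>\<^sub>l \<Theta>\<^sub>l (\<psi>\<^sub>l f)\<close>. All substituted series \<open>E\<^sub>U\<close> of the theorem have the form
  \<open>M (1 - x\<^sup>k U)\<close>, so everything follows from two properties of \<open>M\<close>.

  First, \<open>M\<close> is multiplicative, which reduces the identity to
  \<open>(1 - a) (1 - b a)\<^sup>-\<^sup>1 (1 - b) = (1 - b) (1 - a b)\<^sup>-\<^sup>1 (1 - a)\<close>. Instead of the Baker-Campbell-Hausdorff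
  formula we use the Euler derivation \<open>D\<close>: both \<open>exp (- X) Z exp X\<close> and \<open>exp (- X) D (exp X)\<close> are
  series in iterated commutators with \<open>X\<close>, hence are compatible with the Lie homomorphism \<open>T\<^sub>l\<close>.
  So \<open>\<Theta>\<^sub>l (F G)\<close> and \<open>\<Theta>\<^sub>l F \<Theta>\<^sub>l G\<close> solve the same linear differential equation.

  Secondly, \<open>M f\<close> has coefficients in the integral form. If \<open>f - 1\<close> is a sum of monomials with
  coefficients in the basis, \<open>M f\<close> is a monomial substitution in the generating series of the
  \<open>Z\<^sub>\<Lambda>\<close>. The coefficients of \<open>M (f + t x\<^sup>k U)\<close> are polynomials in the integer \<open>t\<close>, and a
  polynomial with values in a subgroup for all large \<open>t\<close> takes all its values there; this
  allows negative multiplicities, i.e. all of \<open>R\<close>.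
\<close>

section \<open>Power series and their formal sums\<close>

lemma scaleQ_zero_right [simp]: "c *\<^sub>Q (0 :: 'a::rat_algebra) = 0"
  using scaleQ_add_right[of c 0 "0 :: 'a"] by simp

lemma scaleQ_zero_left [simp]: "0 *\<^sub>Q (x :: 'a::rat_algebra) = 0"
  using scaleQ_add_left[of 0 0 x] by simp

lemma scaleQ_minus_right: "c *\<^sub>Q (- x :: 'a::rat_algebra) = - (c *\<^sub>Q x)"
  using scaleQ_add_right[of c x "- x"] by (simp add: eq_neg_iff_add_eq_0 add.commute)

lemma scaleQ_diff_right: "c *\<^sub>Q (x - y :: 'a::rat_algebra) = c *\<^sub>Q x - c *\<^sub>Q y"
  using scaleQ_add_right[of c x "- y"] by (simp add: scaleQ_minus_right)

lemma scaleQ_minus_left: "(- c) *\<^sub>Q (x :: 'a::rat_algebra) = - (c *\<^sub>Q x)"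
  using scaleQ_add_left[of c "- c" x] by (simp add: eq_neg_iff_add_eq_0 add.commute)

lemma scaleQ_sum_right: "c *\<^sub>Q (\<Sum>i\<in>I. f i :: 'a::rat_algebra) = (\<Sum>i\<in>I. c *\<^sub>Q f i)"
  by (induction I rule: infinite_finite_induct) (simp_all add: scaleQ_add_right)

lemma scaleQ_sum_left: "(\<Sum>i\<in>I. c i) *\<^sub>Q (x :: 'a::rat_algebra) = (\<Sum>i\<in>I. c i *\<^sub>Q x)"
  by (induction I rule: infinite_finite_induct) (simp_all add: scaleQ_add_left)

lemma scaleQ_cancel:
  fixes x y :: "'a::rat_algebra"
  assumes "c *\<^sub>Q x = c *\<^sub>Q y" "c \<noteq> 0"
  shows "x = y"
proof -
  have "(1 / c) *\<^sub>Q c *\<^sub>Q x = (1 / c) *\<^sub>Q c *\<^sub>Q y" using assms by simp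
  then show ?thesis using assms(2) by (simp add: scaleQ_scaleQ scaleQ_one)
qed

lemmas scaleQ_simps = scaleQ_scaleQ scaleQ_one scaleQ_mult_left scaleQ_mult_right

instantiation mps :: (type, rat_algebra) rat_algebra
begin
lift_definition scaleQ_mps :: "rat \<Rightarrow> ('a, 'b) mps \<Rightarrow> ('a, 'b) mps" is "\<lambda>c f m. c *\<^sub>Q f m" .
instance
  by standard (auto intro!: mps_eqI sum.cong simp: mps_nth_simps scaleQ_mps.rep_eq scaleQ_add_right
      scaleQ_add_left scaleQ_simps scaleQ_sum_right)
end

lemmas mps_nth_scaleQ = scaleQ_mps.rep_eq

lemma mps_nth_Abs [simp]: "mps_nth (Abs_mps f) m = f m"
  by (simp add: Abs_mps_inverse)

lemma mps_nth_sum: "mps_nth (\<Sum>i\<in>I. f i :: ('v, 'a::ab_group_add) mps) m = (\<Sum>i\<in>I. mps_nth (f i) m)"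
  by (induction I rule: infinite_finite_induct) (simp_all add: mps_nth_simps)

lemma mps_nth_monom: "mps_nth (mps_monom k a) m = (if m = k then a else 0)"
  by (simp add: mps_monom_def)

lemma mps_nth_map: "mps_nth (mps_map h f) m = h (mps_nth f m)"
  by (simp add: mps_map_def)

lemma splittings_zero: "splittings (0 :: 'v \<Rightarrow>\<^sub>0 nat) = {(0, 0)}"
proof -
  have z: "a = 0 \<and> b = 0" if "a + b = (0 :: 'v \<Rightarrow>\<^sub>0 nat)" for a b
  proof -
    have "Poly_Mapping.lookup a x + Poly_Mapping.lookup b x = 0" for x
      by (metis that lookup_add lookup_zero)
    then show ?thesis by (auto intro!: poly_mapping_eqI)
  qed
  have "(a + b = 0) = (a = 0 \<and> b = 0)" for a b :: "'v \<Rightarrow>\<^sub>0 nat"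
    using z[of a b] by (metis add_0)
  then show ?thesis by (simp add: splittings_def)
qed

lemma mps_nth_mult_zero [simp]:
  "mps_nth (f * g) 0 = mps_nth f 0 * mps_nth (g :: ('v, 'a::ring) mps) 0"
  by (simp add: times_mps.rep_eq splittings_zero)

lemma mps_nth_power_zero [simp]:
  "mps_nth (f ^ n) 0 = mps_nth (f :: ('v, 'a::{ring, monoid_mult}) mps) 0 ^ n"
  by (induction n) (simp_all add: one_mps.rep_eq)

section \<open>Total degree and order of vanishing\<close>

definition mdeg :: "('v \<Rightarrow>\<^sub>0 nat) \<Rightarrow> nat" where
  "mdeg m = Sum_any (Poly_Mapping.lookup m)"

lemma mdeg_add [simp]: "mdeg (a + b) = mdeg a + mdeg b"
  unfolding mdeg_def lookup_add by (rule Sum_any.distrib) (simp_all add: finite_lookup)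

lemma mdeg_zero [simp]: "mdeg 0 = 0"
  by (simp add: mdeg_def)

lemma mdeg_single [simp]: "mdeg (Poly_Mapping.single v k) = k"
  by (simp add: mdeg_def lookup_single when_def)

lemma lookup_le_mdeg: "Poly_Mapping.lookup m v \<le> mdeg m"
proof (cases "Poly_Mapping.lookup m v = 0")
  case False
  then show ?thesis
    unfolding mdeg_def Sum_any.expand_set by (intro member_le_sum) (auto simp: finite_lookup)
qed simp

lemma mdeg_eq_0_iff [simp]: "mdeg m = 0 \<longleftrightarrow> m = 0"
  using lookup_le_mdeg[of m] by (auto intro!: poly_mapping_eqI)

lemma mdeg_splittings: "(a, b) \<in> splittings m \<Longrightarrow> mdeg m = mdeg a + mdeg b"
  by (auto simp: splittings_def)

text \<open>The order of \<open>f\<close> is at least \<open>n\<close>. This filtration by total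
  degree controls every infinite sum and product below.\<close>

definition vanish :: "nat \<Rightarrow> ('v, 'a::zero) mps \<Rightarrow> bool" where
  "vanish n f \<longleftrightarrow> (\<forall>m. mdeg m < n \<longrightarrow> mps_nth f m = 0)"

lemma vanishD: "vanish n f \<Longrightarrow> mdeg m < n \<Longrightarrow> mps_nth f m = 0"
  by (simp add: vanish_def)

lemma vanish_0 [simp]: "vanish 0 f"
  by (simp add: vanish_def)

lemma vanish_Suc_0: "vanish (Suc 0) f \<longleftrightarrow> mps_nth f 0 = 0"
  by (auto simp: vanish_def)

lemma vanish_mono: "vanish n f \<Longrightarrow> k \<le> n \<Longrightarrow> vanish k f"
  by (simp add: vanish_def)

lemma vanish_mult:
  fixes f g :: "('v, 'a::ring) mps"
  assumes "vanish k f" "vanish n g"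
  shows "vanish (k + n) (f * g)"
  unfolding vanish_def times_mps.rep_eq
proof (intro allI impI sum.neutral ballI)
  fix m :: "'v \<Rightarrow>\<^sub>0 nat" and p
  assume m: "mdeg m < k + n" and p: "p \<in> splittings m"
  obtain a b where [simp]: "p = (a, b)" by (cases p)
  have "mdeg m = mdeg a + mdeg b" using p mdeg_splittings by auto
  then have "mdeg a < k \<or> mdeg b < n" using m by linarith
  then show "(case p of (a, b) \<Rightarrow> mps_nth f a * mps_nth g b) = 0"
    using assms by (auto simp: vanish_def)
qed

lemma vanish_mult_left: "vanish n g \<Longrightarrow> vanish n (f * g :: ('v, 'a::ring) mps)"
  using vanish_mult[of 0 f n g] by simp

lemma vanish_mult_right: "vanish n f \<Longrightarrow> vanish n (f * g :: ('v, 'a::ring) mps)"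
  using vanish_mult[of n f 0 g] by simp

lemma vanish_power:
  fixes f :: "('v, 'a::{ring, monoid_mult}) mps"
  shows "mps_nth f 0 = 0 \<Longrightarrow> vanish n (f ^ n)"
  using vanish_mult[of 1 f] by (induction n) (simp_all add: vanish_Suc_0)

lemma vanish_scaleQ: "vanish n f \<Longrightarrow> vanish n (c *\<^sub>Q f)"
  by (simp add: vanish_def mps_nth_scaleQ)

lemma vanish_add: "vanish n f \<Longrightarrow> vanish n g \<Longrightarrow> vanish n (f + g :: ('v, 'a::ab_group_add) mps)"
  by (simp add: vanish_def mps_nth_simps)

lemma vanish_sum:
  "(\<And>i. i \<in> I \<Longrightarrow> vanish n (f i :: ('v, 'a::ab_group_add) mps)) \<Longrightarrow> vanish n (\<Sum>i\<in>I. f i)"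
  by (simp add: vanish_def mps_nth_sum)

text \<open>The cut-off at \<open>mdeg m\<close> keeps every coefficient a finite sum. It yields the
  true formal sum when the \<open>n\<close>-th term has order at least \<open>n\<close>, which is
  the hypothesis carried by the lemmas on products and shifts.\<close>

definition mps_sum :: "(nat \<Rightarrow> ('v, 'a::ab_group_add) mps) \<Rightarrow> ('v, 'a) mps" where
  "mps_sum X = Abs_mps (\<lambda>m. \<Sum>n\<le>mdeg m. mps_nth (X n) m)"

lemma mps_nth_mps_sum:
  assumes "\<And>n. vanish n (X n)" "mdeg m \<le> N"
  shows "mps_nth (mps_sum X) m = (\<Sum>n\<le>N. mps_nth (X n) m)"
  unfolding mps_sum_def mps_nth_Abs
  using assms by (intro sum.mono_neutral_left) (auto simp: vanish_def not_le[symmetric])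

lemma Sum_any_vanish:
  assumes "\<And>n. vanish n (X n)"
  shows "Sum_any (\<lambda>n. mps_nth (X n) m) = mps_nth (mps_sum X) m"
proof -
  have sub: "{n. mps_nth (X n) m \<noteq> 0} \<subseteq> {..mdeg m}"
    using assms by (auto simp: vanish_def intro: leI)
  show ?thesis
    unfolding mps_sum_def mps_nth_Abs by (rule Sum_any.expand_superset[OF _ sub]) simp
qed

lemma mps_sum_mult_left:
  fixes X :: "nat \<Rightarrow> ('v, 'a::ring) mps"
  assumes X: "\<And>n. vanish n (X n)"
  shows "f * mps_sum X = mps_sum (\<lambda>n. f * X n)"
proof (rule mps_eqI)
  fix m :: "'v \<Rightarrow>\<^sub>0 nat"
  have "mps_nth (f * mps_sum X) m
      = (\<Sum>p\<in>splittings m. mps_nth f (fst p) * (\<Sum>n\<le>mdeg m. mps_nth (X n) (snd p)))"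
    unfolding times_mps.rep_eq case_prod_unfold
    by (intro sum.cong refl arg_cong2[of _ _ _ _ "(*)"] mps_nth_mps_sum X)
       (auto simp: mdeg_splittings)
  also have "\<dots> = (\<Sum>n\<le>mdeg m. mps_nth (f * X n) m)"
    unfolding times_mps.rep_eq case_prod_unfold sum_distrib_left by (rule sum.swap)
  finally show "mps_nth (f * mps_sum X) m = mps_nth (mps_sum (\<lambda>n. f * X n)) m"
    by (simp add: mps_sum_def)
qed

lemma mps_sum_mult_right:
  fixes X :: "nat \<Rightarrow> ('v, 'a::ring) mps"
  assumes X: "\<And>n. vanish n (X n)"
  shows "mps_sum X * f = mps_sum (\<lambda>n. X n * f)"
proof (rule mps_eqI)
  fix m :: "'v \<Rightarrow>\<^sub>0 nat"
  have "mps_nth (mps_sum X * f) m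
      = (\<Sum>p\<in>splittings m. (\<Sum>n\<le>mdeg m. mps_nth (X n) (fst p)) * mps_nth f (snd p))"
    unfolding times_mps.rep_eq case_prod_unfold
    by (intro sum.cong refl arg_cong2[of _ _ _ _ "(*)"] mps_nth_mps_sum X)
       (auto simp: mdeg_splittings)
  also have "\<dots> = (\<Sum>n\<le>mdeg m. mps_nth (X n * f) m)"
    unfolding times_mps.rep_eq case_prod_unfold sum_distrib_right by (rule sum.swap)
  finally show "mps_nth (mps_sum X * f) m = mps_nth (mps_sum (\<lambda>n. X n * f)) m"
    by (simp add: mps_sum_def)
qed

lemma mps_sum_0_shift:
  assumes X: "\<And>n. vanish n (X n)"
  shows "mps_sum X = X 0 + mps_sum (\<lambda>n. X (Suc n))"
proof (rule mps_eqI)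
  fix m
  \<comment> \<open>The extra index \<open>Suc (mdeg m)\<close> contributes zero; it is included so
    that the shifted sum runs exactly up to \<open>mdeg m\<close>.\<close>
  have "mps_nth (mps_sum X) m = (\<Sum>n\<le>Suc (mdeg m). mps_nth (X n) m)"
    by (rule mps_nth_mps_sum[OF X]) simp
  then show "mps_nth (mps_sum X) m = mps_nth (X 0 + mps_sum (\<lambda>n. X (Suc n))) m"
    by (simp add: sum.atMost_Suc_shift mps_sum_def mps_nth_simps del: sum.atMost_Suc)
qed

lemma vanish_Cauchy:
  fixes X Y :: "nat \<Rightarrow> ('v, 'a::ring) mps"
  assumes X: "\<And>n. vanish n (X n)" and Y: "\<And>n. vanish n (Y n)"
  shows "vanish n (\<Sum>i\<le>n. X i * Y (n - i))"
proof (rule vanish_sum)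
  fix i assume "i \<in> {..n}"
  then show "vanish n (X i * Y (n - i))"
    using vanish_mult[OF X Y, of i "n - i"] by simp
qed

lemma mps_sum_Cauchy:
  fixes X Y :: "nat \<Rightarrow> ('v, 'a::ring) mps"
  assumes X: "\<And>n. vanish n (X n)" and Y: "\<And>n. vanish n (Y n)"
  shows "mps_sum X * mps_sum Y = mps_sum (\<lambda>n. \<Sum>i\<le>n. X i * Y (n - i))"
proof (rule mps_eqI)
  fix m :: "'v \<Rightarrow>\<^sub>0 nat"
  let ?N = "mdeg m"
  have "mps_nth (mps_sum X * mps_sum Y) m = (\<Sum>i\<le>?N. mps_nth (X i * mps_sum Y) m)"
    by (simp add: mps_sum_mult_right X) (simp add: mps_sum_def)
  also have "\<dots> = (\<Sum>i\<le>?N. \<Sum>j\<le>?N. mps_nth (X i * Y j) m)"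
    by (simp add: mps_sum_mult_left Y) (simp add: mps_sum_def)
  also have "\<dots> = (\<Sum>(i, j)\<in>{..?N} \<times> {..?N}. mps_nth (X i * Y j) m)"
    by (simp add: sum.cartesian_product)
  \<comment> \<open>Terms of the square outside the triangle have order at least
    \<open>i + j > mdeg m\<close> and so vanish at \<open>m\<close>.\<close>
  also have "\<dots> = (\<Sum>(i, j)\<in>{(i, j). i + j \<le> ?N}. mps_nth (X i * Y j) m)"
  proof (rule sum.mono_neutral_right)
    show "\<forall>p\<in>{..?N} \<times> {..?N} - {(i, j). i + j \<le> ?N}.
        (case p of (i, j) \<Rightarrow> mps_nth (X i * Y j) m) = 0"
      using vanish_mult[OF X Y] by (auto simp: vanish_def not_le[symmetric])
  qed auto
  also have "\<dots> = (\<Sum>n\<le>?N. \<Sum>i\<le>n. mps_nth (X i * Y (n - i)) m)"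
    by (rule sum.triangle_reindex_eq)
  finally show "mps_nth (mps_sum X * mps_sum Y) m
      = mps_nth (mps_sum (\<lambda>n. \<Sum>i\<le>n. X i * Y (n - i))) m"
    by (simp add: mps_sum_def mps_nth_sum)
qed

section \<open>Exponential and logarithm\<close>

text \<open>Powers of a single \<open>Y\<close> commute, so for \<open>Y\<close> without constant
  term evaluation is a ring homomorphism even over noncommutative coefficients. Identities between
  exp and log can therefore be imported from one-variable series over the rationals.\<close>

definition fps_eval :: "rat fps \<Rightarrow> ('v, 'a::rat_algebra) mps \<Rightarrow> ('v, 'a) mps" where
  "fps_eval f Y = mps_sum (\<lambda>n. fps_nth f n *\<^sub>Q Y ^ n)"

lemma vanish_fps_eval: "mps_nth Y 0 = 0 \<Longrightarrow> vanish n (c *\<^sub>Q Y ^ n)"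
  by (simp add: vanish_scaleQ vanish_power)

lemma fps_eval_mult:
  assumes Y: "mps_nth Y 0 = 0"
  shows "fps_eval (f * g) Y = fps_eval f Y * fps_eval g Y"
proof -
  have "(\<Sum>i\<le>n. fps_nth f i *\<^sub>Q Y ^ i * fps_nth g (n - i) *\<^sub>Q Y ^ (n - i))
      = fps_nth (f * g) n *\<^sub>Q Y ^ n" for n
  proof -
    have "(\<Sum>i\<le>n. fps_nth f i *\<^sub>Q Y ^ i * fps_nth g (n - i) *\<^sub>Q Y ^ (n - i))
        = (\<Sum>i\<le>n. (fps_nth f i * fps_nth g (n - i)) *\<^sub>Q Y ^ n)"
      by (intro sum.cong refl) (simp add: scaleQ_simps mult.commute flip: power_add)
    then show ?thesis by (simp add: fps_mult_nth atMost_atLeast0 scaleQ_sum_left)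
  qed
  then show ?thesis
    unfolding fps_eval_def using Y by (subst mps_sum_Cauchy) (simp_all add: vanish_fps_eval)
qed

lemma fps_eval_1: "mps_nth Y 0 = 0 \<Longrightarrow> fps_eval 1 Y = 1"
  unfolding fps_eval_def
  by (subst mps_sum_0_shift) (auto intro!: mps_eqI simp: vanish_fps_eval scaleQ_one mps_sum_def mps_nth_simps)

lemma fps_eval_power: "mps_nth Y 0 = 0 \<Longrightarrow> fps_eval (f ^ n) Y = fps_eval f Y ^ n"
  by (induction n) (simp_all add: fps_eval_1 fps_eval_mult)

lemma fps_eval_nth:
  "mps_nth Y 0 = 0 \<Longrightarrow> mdeg m \<le> N \<Longrightarrow>
    mps_nth (fps_eval f Y) m = (\<Sum>n\<le>N. fps_nth f n *\<^sub>Q mps_nth (Y ^ n) m)"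
  unfolding fps_eval_def
  by (subst mps_nth_mps_sum) (auto simp: vanish_fps_eval mps_nth_scaleQ)

lemma fps_eval_nth_0: "mps_nth (fps_eval f Y) 0 = fps_nth f 0 *\<^sub>Q 1"
  by (simp add: fps_eval_def mps_sum_def mps_nth_scaleQ one_mps.rep_eq)

lemma fps_eval_compose:
  fixes Y :: "('v, 'a::rat_algebra) mps"
  assumes Y: "mps_nth Y 0 = 0" and g: "fps_nth g 0 = 0"
  shows "fps_eval (f oo g) Y = fps_eval f (fps_eval g Y)"
proof (rule mps_eqI)
  fix m :: "'v \<Rightarrow>\<^sub>0 nat"
  let ?N = "mdeg m"
  have g': "mps_nth (fps_eval g Y) 0 = 0" by (simp add: fps_eval_nth_0 g)
  have "mps_nth (fps_eval (f oo g) Y) m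
      = (\<Sum>k\<le>?N. (\<Sum>i\<le>?N. fps_nth f i * fps_nth (g ^ i) k) *\<^sub>Q mps_nth (Y ^ k) m)"
    unfolding fps_eval_nth[OF Y order.refl]
  proof (intro sum.cong refl arg_cong2[of _ _ _ _ scaleQ])
    \<comment> \<open>The composition formula sums over \<open>i\<close> up to \<open>k\<close>
      only; for \<open>i > k\<close> the power \<open>g ^ i\<close> has no term of degree
      \<open>k\<close>.\<close>
    fix k assume "k \<in> {..?N}"
    then show "fps_nth (f oo g) k = (\<Sum>i\<le>?N. fps_nth f i * fps_nth (g ^ i) k)"
      unfolding fps_compose_nth
      by (intro sum.mono_neutral_left)
         (auto simp: startsby_zero_power_prefix[OF g] not_le[symmetric])
  qed
  also have "\<dots> = (\<Sum>i\<le>?N. fps_nth f i *\<^sub>Q (\<Sum>k\<le>?N. fps_nth (g ^ i) k *\<^sub>Q mps_nth (Y ^ k) m))"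
    by (simp add: scaleQ_sum_left scaleQ_sum_right scaleQ_scaleQ) (rule sum.swap)
  also have "\<dots> = mps_nth (fps_eval f (fps_eval g Y)) m"
    by (simp add: fps_eval_nth[OF g' order.refl] fps_eval_nth[OF Y order.refl] fps_eval_power[OF Y, symmetric])
  finally show "mps_nth (fps_eval (f oo g) Y) m = mps_nth (fps_eval f (fps_eval g Y)) m" .
qed

text \<open>Divided powers are the terms of the exponential; the recursions
  \<open>dpower_Suc\<close> and \<open>dpower_Suc'\<close> are its differential equation, written
  without denominators.\<close>

definition dpower :: "'a::rat_algebra \<Rightarrow> nat \<Rightarrow> 'a" where
  "dpower x n = (1 / fact n) *\<^sub>Q x ^ n"

lemma dpower_0 [simp]: "dpower x 0 = 1"
  by (simp add: dpower_def scaleQ_one)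

lemma dpower_Suc: "of_nat (Suc n) *\<^sub>Q dpower x (Suc n) = x * dpower x n"
  by (simp add: dpower_def scaleQ_simps del: of_nat_Suc)

lemma dpower_Suc': "of_nat (Suc n) *\<^sub>Q dpower x (Suc n) = dpower x n * x"
  by (simp add: dpower_def scaleQ_simps power_commutes del: of_nat_Suc)

lemma vanish_dpower: "mps_nth X 0 = 0 \<Longrightarrow> vanish n (dpower X n)"
  by (simp add: dpower_def vanish_fps_eval)

lemma mps_exp_eq: "mps_nth X 0 = 0 \<Longrightarrow> mps_exp X = mps_sum (dpower X)"
  by (rule mps_eqI)
     (simp add: mps_exp_def vanish_dpower flip: Sum_any_vanish, simp add: dpower_def mps_nth_scaleQ)

lemma mps_exp_eq_fps_eval: "mps_nth X 0 = 0 \<Longrightarrow> mps_exp X = fps_eval (fps_exp 1) X"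
  by (simp add: mps_exp_eq fps_eval_def dpower_def[abs_def])

lemma mps_log_eq_fps_eval:
  assumes F: "mps_nth F 0 = 1"
  shows "mps_log F = fps_eval (fps_ln 1) (F - 1)"
proof -
  have Y: "mps_nth (F - 1) 0 = 0" by (simp add: F mps_nth_simps)
  \<comment> \<open>\<open>mps_log\<close> starts its index at the linear term, whereas
    \<open>fps_ln\<close> has a zero coefficient at index 0; hence the shift by one.\<close>
  let ?X = "\<lambda>n. fps_nth (fps_ln 1) (Suc n) *\<^sub>Q (F - 1) ^ Suc n"
  have v: "vanish n (?X n)" for n
    using vanish_mono[OF vanish_fps_eval[OF Y], of n "Suc n"] by simp
  have "fps_eval (fps_ln 1) (F - 1) = mps_sum ?X"
    unfolding fps_eval_def
    by (subst mps_sum_0_shift) (simp_all add: vanish_fps_eval[OF Y] del: power_Suc)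
  moreover have "mps_log F = mps_sum ?X"
  proof (rule mps_eqI)
    fix m
    have "mps_nth (mps_log F) m = Sum_any (\<lambda>n. mps_nth (?X n) m)"
      by (simp add: mps_log_def fps_ln_nth mps_nth_scaleQ del: power_Suc of_nat_Suc)
    also have "\<dots> = mps_nth (mps_sum ?X) m"
      by (rule Sum_any_vanish[OF v])
    finally show "mps_nth (mps_log F) m = mps_nth (mps_sum ?X) m" .
  qed
  ultimately show ?thesis by simp
qed

lemma mps_exp_nth_0: "mps_nth X 0 = 0 \<Longrightarrow> mps_nth (mps_exp X) 0 = 1"
  by (simp add: mps_exp_eq_fps_eval fps_eval_nth_0 scaleQ_one)

lemma mps_log_nth_0: "mps_nth F 0 = 1 \<Longrightarrow> mps_nth (mps_log F) 0 = 0"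
  by (simp add: mps_log_eq_fps_eval fps_eval_nth_0)

lemma mps_exp_log:
  assumes F: "mps_nth F 0 = 1"
  shows "mps_exp (mps_log F) = F"
proof -
  have Y: "mps_nth (F - 1) 0 = 0" by (simp add: F mps_nth_simps)
  \<comment> \<open>\<open>fps_ln 1\<close> is the series of log (1 + x), the compositional inverse
    of e^x - 1.\<close>
  have "(fps_exp 1 - 1) oo fps_ln (1 :: rat) = fps_X"
    by (simp add: fps_ln_fps_exp_inv fps_inv_fps_exp_compose)
  then have comp: "fps_exp 1 oo fps_ln (1 :: rat) = 1 + fps_X"
    by (simp add: fps_compose_sub_distrib diff_eq_eq add.commute)
  have "mps_nth (fps_eval (fps_ln 1) (F - 1)) 0 = 0" by (simp add: fps_eval_nth_0)
  then have "mps_exp (mps_log F) = fps_eval (1 + fps_X) (F - 1)"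
    by (simp add: mps_log_eq_fps_eval[OF F] mps_exp_eq_fps_eval fps_eval_compose[OF Y, symmetric] comp)
  also have "\<dots> = F"
  proof (rule mps_eqI)
    fix m
    \<comment> \<open>Summing up to \<open>Suc (mdeg m)\<close> ensures that the linear term is
      present even when \<open>mdeg m = 0\<close>.\<close>
    have "mps_nth (fps_eval (1 + fps_X) (F - 1)) m
        = (\<Sum>n\<le>Suc (mdeg m). fps_nth (1 + fps_X) n *\<^sub>Q mps_nth ((F - 1) ^ n) m)"
      by (rule fps_eval_nth[OF Y]) simp
    also have "\<dots> = mps_nth 1 m + (mps_nth (F - 1) m
        + (\<Sum>n<mdeg m. fps_nth (1 + fps_X) (Suc (Suc n)) *\<^sub>Q mps_nth ((F - 1) ^ Suc (Suc n)) m))"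
      by (simp add: lessThan_Suc_atMost[symmetric] sum.lessThan_Suc_shift scaleQ_one del: power_Suc sum.lessThan_Suc)
    also have "(\<Sum>n<mdeg m. fps_nth (1 + fps_X) (Suc (Suc n)) *\<^sub>Q mps_nth ((F - 1) ^ Suc (Suc n)) m) = 0"
      by simp
    finally show "mps_nth (fps_eval (1 + fps_X) (F - 1)) m = mps_nth F m"
      by (simp add: mps_nth_simps)
  qed
  finally show ?thesis .
qed

text \<open>
  If \<open>B j\<close> and \<open>C j\<close> are the coefficients of \<open>t\<^sup>j\<close> in series with \<open>B' = x B + C\<close>, this compares the
  coefficients of \<open>t\<^sup>n\<close> in \<open>(exp (- t x) B)' = exp (- t x) C\<close>.
\<close>

lemma sum_dpower_step:
  fixes x :: "'a::rat_algebra"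
  assumes B: "\<And>j. of_nat (Suc j) *\<^sub>Q B (Suc j) = x * B j + C j"
  shows "of_nat (Suc n) *\<^sub>Q (\<Sum>i\<le>Suc n. dpower (- x) i * B (Suc n - i))
    = (\<Sum>i\<le>n. dpower (- x) i * C (n - i))"
proof -
  have "of_nat (Suc n) *\<^sub>Q (\<Sum>i\<le>Suc n. dpower (- x) i * B (Suc n - i))
    = (\<Sum>i\<le>Suc n. (of_nat i *\<^sub>Q dpower (- x) i) * B (Suc n - i))
     + (\<Sum>i\<le>Suc n. dpower (- x) i * (of_nat (Suc n - i) *\<^sub>Q B (Suc n - i)))"
    unfolding scaleQ_sum_right sum.distrib[symmetric]
  proof (intro sum.cong refl)
    fix i assume "i \<in> {..Suc n}"
    \<comment> \<open>Leibniz rule in t: the factor n + 1 is divided between the two factors of the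
      product.\<close>
    then have "of_nat (Suc n) = (of_nat i + of_nat (Suc n - i) :: rat)"
      by (simp flip: of_nat_add)
    then show "of_nat (Suc n) *\<^sub>Q (dpower (- x) i * B (Suc n - i))
        = of_nat i *\<^sub>Q dpower (- x) i * B (Suc n - i)
          + dpower (- x) i * of_nat (Suc n - i) *\<^sub>Q B (Suc n - i)"
      by (simp only: scaleQ_add_left scaleQ_simps)
  qed
  \<comment> \<open>The weight \<open>of_nat i\<close> kills the term i = 0 here, and
    \<open>of_nat (Suc n - i)\<close> kills the term i = n + 1 in the other sum; both sums then run
    over i up to n.\<close>
  also have "(\<Sum>i\<le>Suc n. (of_nat i *\<^sub>Q dpower (- x) i) * B (Suc n - i))
      = (\<Sum>i\<le>n. dpower (- x) i * (- x) * B (n - i))"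
    unfolding sum.atMost_Suc_shift by (simp add: dpower_Suc' del: of_nat_Suc)
  also have "(\<Sum>i\<le>Suc n. dpower (- x) i * (of_nat (Suc n - i) *\<^sub>Q B (Suc n - i)))
      = (\<Sum>i\<le>n. dpower (- x) i * (x * B (n - i) + C (n - i)))"
    unfolding sum.atMost_Suc by (simp add: Suc_diff_le B del: of_nat_Suc)
  finally show ?thesis
    by (simp add: distrib_left mult.assoc sum.distrib sum_negf)
qed

section \<open>Lie homomorphisms applied to logarithms\<close>

text \<open>This is minus the adjoint action of \<open>x\<close>; with this sign the expansion of
  exp (-x) z exp x has no alternating signs.\<close>

definition comm_op :: "'a::ring \<Rightarrow> 'a \<Rightarrow> 'a" where
  "comm_op x z = z * x - x * z"

text \<open>The left side is the coefficient of t^n in exp (-t x) z exp (t x). Differentiating in t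
  replaces z by its commutator with x, hence the induction with \<open>z\<close> arbitrary.\<close>

lemma sum_dpower_conj:
  fixes x z :: "'a::rat_algebra"
  shows "(\<Sum>i\<le>n. dpower (- x) i * (z * dpower x (n - i))) = (1 / fact n) *\<^sub>Q (comm_op x ^^ n) z"
proof (induction n arbitrary: z)
  case 0
  then show ?case by (simp add: scaleQ_one)
next
  case (Suc n)
  have "of_nat (Suc j) *\<^sub>Q (z * dpower x (Suc j))
      = x * (z * dpower x j) + comm_op x z * dpower x j" for j
    by (simp add: dpower_Suc comm_op_def algebra_simps del: of_nat_Suc flip: scaleQ_mult_right)
  then have "of_nat (Suc n) *\<^sub>Q (\<Sum>i\<le>Suc n. dpower (- x) i * (z * dpower x (Suc n - i)))
      = (\<Sum>i\<le>n. dpower (- x) i * (comm_op x z * dpower x (n - i)))"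
    by (rule sum_dpower_step)
  also have "\<dots> = (1 / fact n) *\<^sub>Q (comm_op x ^^ n) (comm_op x z)"
    by (rule Suc)
  also have "\<dots> = of_nat (Suc n) *\<^sub>Q (1 / fact (Suc n)) *\<^sub>Q (comm_op x ^^ Suc n) z"
    by (simp add: scaleQ_scaleQ funpow_Suc_right del: of_nat_Suc funpow.simps)
  finally show ?case by (rule scaleQ_cancel) (simp del: of_nat_Suc)
qed

lemma mps_exp_conj:
  fixes X Z :: "('v, 'a::rat_algebra) mps"
  assumes X: "mps_nth X 0 = 0"
  shows "mps_exp (- X) * (Z * mps_exp X) = mps_sum (\<lambda>n. (1 / fact n) *\<^sub>Q (comm_op X ^^ n) Z)"
proof -
  have X': "mps_nth (- X) 0 = 0" by (simp add: X mps_nth_simps)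
  have "Z * mps_exp X = mps_sum (\<lambda>n. Z * dpower X n)"
    by (simp add: mps_exp_eq X mps_sum_mult_left vanish_dpower)
  then show ?thesis
    by (simp add: mps_exp_eq[OF X'] mps_sum_Cauchy X X' vanish_dpower vanish_mult_left sum_dpower_conj)
qed

lemma comm_op_zero_right [simp]: "comm_op x 0 = 0"
  by (simp add: comm_op_def)

lemma comm_op_one_right: "comm_op x 1 = (0 :: 'a::{ring, monoid_mult})"
  by (simp add: comm_op_def)

text \<open>The conjugation formula for \<open>Z = 1\<close>: every commutator with 1 is zero, so
  only the term \<open>n = 0\<close> survives.\<close>

lemma mps_exp_inverse_left:
  assumes X: "mps_nth X 0 = 0"
  shows "mps_exp (- X) * mps_exp X = 1"
proof -
  have 0: "(comm_op X ^^ n) 0 = 0" for n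
    by (induction n) simp_all
  have "(1 / fact n) *\<^sub>Q (comm_op X ^^ n) 1 = (if n = 0 then 1 else 0)" for n
    by (cases n) (simp_all add: funpow_Suc_right comm_op_one_right scaleQ_one 0 del: funpow.simps)
  then have "mps_exp (- X) * (1 * mps_exp X) = mps_sum (\<lambda>n. if n = 0 then 1 else 0)"
    by (simp only: mps_exp_conj[OF X])
  also have "\<dots> = 1"
    by (rule mps_eqI) (simp add: mps_sum_def mps_nth_simps if_distrib[of "\<lambda>f. mps_nth f _"] cong: if_cong)
  finally show ?thesis by simp
qed

lemma mps_exp_inverse_right:
  assumes "mps_nth X 0 = 0"
  shows "mps_exp X * mps_exp (- X) = 1"
  using mps_exp_inverse_left[of "- X"] assms by (simp add: mps_nth_simps)

text \<open>The derivation that multiplies the part of degree d by d. It needs no choice of a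
  variable, and over the rationals it kills only constants, so first-order equations have unique
  solutions.\<close>

definition mps_euler :: "('v, 'a::rat_algebra) mps \<Rightarrow> ('v, 'a) mps" where
  "mps_euler f = Abs_mps (\<lambda>m. of_nat (mdeg m) *\<^sub>Q mps_nth f m)"

lemma mps_euler_mult: "mps_euler (f * g) = mps_euler f * g + f * mps_euler g"
proof (rule mps_eqI)
  fix m
  have "mps_nth (mps_euler (f * g)) m
      = (\<Sum>p\<in>splittings m. of_nat (mdeg m) *\<^sub>Q (mps_nth f (fst p) * mps_nth g (snd p)))"
    by (simp add: mps_euler_def times_mps.rep_eq case_prod_unfold scaleQ_sum_right)
  also have "\<dots> = (\<Sum>p\<in>splittings m. of_nat (mdeg (fst p)) *\<^sub>Q mps_nth f (fst p) * mps_nth g (snd p)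
      + mps_nth f (fst p) * of_nat (mdeg (snd p)) *\<^sub>Q mps_nth g (snd p))"
    by (intro sum.cong refl)
       (auto simp: scaleQ_simps scaleQ_add_left[symmetric] splittings_def)
  finally show "mps_nth (mps_euler (f * g)) m = mps_nth (mps_euler f * g + f * mps_euler g) m"
    by (simp add: mps_euler_def mps_nth_simps case_prod_unfold sum.distrib)
qed

lemma mps_euler_scaleQ: "mps_euler (c *\<^sub>Q f) = c *\<^sub>Q mps_euler f"
  by (rule mps_eqI) (simp add: mps_euler_def mps_nth_scaleQ scaleQ_scaleQ mult.commute)

lemma mps_euler_diff: "mps_euler (f - g) = mps_euler f - mps_euler g"
  by (rule mps_eqI) (simp add: mps_euler_def mps_nth_simps scaleQ_diff_right)

lemma mps_euler_one: "mps_euler 1 = 0"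
  by (rule mps_eqI) (simp add: mps_euler_def mps_nth_simps)

lemma mps_nth_euler_0: "mps_nth (mps_euler f) 0 = 0"
  by (simp add: mps_euler_def)

lemma mps_euler_sum: "mps_euler (mps_sum X) = mps_sum (\<lambda>n. mps_euler (X n))"
  by (rule mps_eqI) (simp add: mps_euler_def mps_sum_def scaleQ_sum_right)

lemma vanish_euler: "vanish n f \<Longrightarrow> vanish n (mps_euler f)"
  by (simp add: vanish_def mps_euler_def)

text \<open>The coefficient of t^(n+1) in exp (-t X) D (exp (t X)). Its derivative in t is exp (-t
  X) (D X) exp (t X), which \<open>sum_dpower_conj\<close> expands.\<close>

lemma sum_dpower_euler:
  fixes X :: "('v, 'a::rat_algebra) mps"
  shows "(\<Sum>i\<le>Suc n. dpower (- X) i * mps_euler (dpower X (Suc n - i)))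
    = (1 / fact (Suc n)) *\<^sub>Q (comm_op X ^^ n) (mps_euler X)"
proof -
  have "of_nat (Suc j) *\<^sub>Q mps_euler (dpower X (Suc j))
      = X * mps_euler (dpower X j) + mps_euler X * dpower X j" for j
    by (simp add: dpower_Suc mps_euler_mult del: of_nat_Suc flip: mps_euler_scaleQ)
  then have "of_nat (Suc n) *\<^sub>Q (\<Sum>i\<le>Suc n. dpower (- X) i * mps_euler (dpower X (Suc n - i)))
      = (\<Sum>i\<le>n. dpower (- X) i * (mps_euler X * dpower X (n - i)))"
    by (rule sum_dpower_step)
  also have "\<dots> = (1 / fact n) *\<^sub>Q (comm_op X ^^ n) (mps_euler X)"
    by (rule sum_dpower_conj)
  also have "\<dots> = of_nat (Suc n) *\<^sub>Q (1 / fact (Suc n)) *\<^sub>Q (comm_op X ^^ n) (mps_euler X)"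
    by (simp add: scaleQ_scaleQ del: of_nat_Suc)
  finally show ?thesis by (rule scaleQ_cancel) (simp del: of_nat_Suc)
qed

text \<open>The classical formula exp (-X) D (exp X) = ((1 - exp (- ad X)) / ad X) (D X).\<close>

lemma mps_exp_euler:
  fixes X :: "('v, 'a::rat_algebra) mps"
  assumes X: "mps_nth X 0 = 0"
  shows "mps_exp (- X) * mps_euler (mps_exp X)
    = mps_sum (\<lambda>n. (1 / fact (Suc n)) *\<^sub>Q (comm_op X ^^ n) (mps_euler X))"
proof -
  have X': "mps_nth (- X) 0 = 0" by (simp add: X mps_nth_simps)
  let ?S = "\<lambda>n. \<Sum>i\<le>n. dpower (- X) i * mps_euler (dpower X (n - i))"
  have v: "vanish n (?S n)" for n
    by (rule vanish_Cauchy) (simp_all add: X X' vanish_dpower vanish_euler)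
  have "mps_exp (- X) * mps_euler (mps_exp X) = mps_sum ?S"
    by (simp add: mps_exp_eq X X' mps_euler_sum mps_sum_Cauchy vanish_dpower vanish_euler)
  also have "\<dots> = ?S 0 + mps_sum (\<lambda>n. ?S (Suc n))"
    by (rule mps_sum_0_shift[OF v])
  also have "?S 0 = 0" by (simp add: mps_euler_one)
  finally show ?thesis by (simp only: sum_dpower_euler add_0)
qed

text \<open>Since \<open>Y\<close> has no constant term, the coefficient of \<open>f * Y\<close> at
  \<open>m\<close> involves only coefficients of \<open>f\<close> of smaller degree; the factor
  \<open>mdeg m\<close> is invertible for nonzero \<open>m\<close>.\<close>

lemma mps_euler_unique:
  fixes f Y :: "('v, 'a::rat_algebra) mps"
  assumes f: "mps_euler f = f * Y" and Y: "mps_nth Y 0 = 0" and f0: "mps_nth f 0 = 0"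
  shows "f = 0"
proof -
  have "mps_nth f m = 0" for m
  proof (induction "mdeg m" arbitrary: m rule: less_induct)
    case less
    show ?case
    proof (cases "m = 0")
      case True
      then show ?thesis using f0 by simp
    next
      case False
      have "of_nat (mdeg m) *\<^sub>Q mps_nth f m = mps_nth (f * Y) m"
        by (simp add: f[symmetric] mps_euler_def)
      also have "\<dots> = 0"
        unfolding times_mps.rep_eq
      proof (intro sum.neutral ballI, clarify)
        fix a b assume ab: "(a, b) \<in> splittings m"
        show "mps_nth f a * mps_nth Y b = 0"
        proof (cases "b = 0")
          case False
          then have "mdeg a < mdeg m" using mdeg_splittings[OF ab] mdeg_eq_0_iff[of b] by linarith
          then show ?thesis using less by simp
        qed (simp add: Y)
      qed
      finally have "of_nat (mdeg m) *\<^sub>Q mps_nth f m = of_nat (mdeg m) *\<^sub>Q 0" by simp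
      then show ?thesis by (rule scaleQ_cancel) (simp add: False)
    qed
  qed
  then show ?thesis by (auto intro: mps_eqI simp: zero_mps.rep_eq)
qed

text \<open>The variables are central, so the commutator of two series is a sum of commutators of
  coefficients. In this form a map that respects only commutators can be applied to it.\<close>

lemma mps_nth_comm_op:
  "mps_nth (comm_op f g) m
    = (\<Sum>(a, b)\<in>splittings m. mps_nth g a * mps_nth f b - mps_nth f b * mps_nth g a)"
proof -
  have "mps_nth (f * g) m = (\<Sum>(a, b)\<in>splittings m. mps_nth f b * mps_nth g a)"
    unfolding times_mps.rep_eq
    by (rule sum.reindex_bij_witness[where i = prod.swap and j = prod.swap])
       (auto simp: splittings_def add.commute)
  then show ?thesis
    by (simp add: comm_op_def minus_mps.rep_eq times_mps.rep_eq sum_subtractf case_prod_unfold)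
qed

text \<open>Modelled on \<open>T l\<close>, which is linear and respects commutators but is not
  multiplicative.\<close>

locale lie_hom =
  fixes h :: "'a::rat_algebra \<Rightarrow> 'b::rat_algebra"
  assumes add: "h (x + y) = h x + h y"
    and scaleQ: "h (c *\<^sub>Q x) = c *\<^sub>Q h x"
    and commutator: "h (x * y - y * x) = h x * h y - h y * h x"
begin

lemma zero [simp]: "h 0 = 0"
  using scaleQ[of 0 0] by simp

lemma sum: "h (\<Sum>i\<in>I. f i) = (\<Sum>i\<in>I. h (f i))"
  by (induction I rule: infinite_finite_induct) (simp_all add: add)

lemma map_add: "mps_map h (f + g) = mps_map h f + mps_map h g"
  by (rule mps_eqI) (simp add: mps_nth_map mps_nth_simps add)

lemma map_scaleQ: "mps_map h (c *\<^sub>Q f) = c *\<^sub>Q mps_map h f"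
  by (rule mps_eqI) (simp add: mps_nth_map mps_nth_scaleQ scaleQ)

lemma map_euler: "mps_map h (mps_euler f) = mps_euler (mps_map h f)"
  by (rule mps_eqI) (simp add: mps_nth_map mps_euler_def scaleQ)

lemma map_sum: "mps_map h (mps_sum X) = mps_sum (\<lambda>n. mps_map h (X n))"
  by (rule mps_eqI) (simp add: mps_nth_map mps_sum_def sum)

lemma map_comm_op: "mps_map h (comm_op f g) = comm_op (mps_map h f) (mps_map h g)"
proof (rule mps_eqI)
  fix m
  show "mps_nth (mps_map h (comm_op f g)) m = mps_nth (comm_op (mps_map h f) (mps_map h g)) m"
    by (simp add: mps_nth_map mps_nth_comm_op sum case_prod_unfold commutator)
qed

lemma map_comm_op_funpow:
  "mps_map h ((comm_op f ^^ n) g) = (comm_op (mps_map h f) ^^ n) (mps_map h g)"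
  by (induction n) (simp_all add: map_comm_op)

lemma map_exp_conj:
  assumes X: "mps_nth X 0 = 0"
  shows "mps_map h (mps_exp (- X) * (Z * mps_exp X))
    = mps_exp (- mps_map h X) * (mps_map h Z * mps_exp (mps_map h X))"
  by (simp add: mps_exp_conj X mps_nth_map map_sum map_scaleQ map_comm_op_funpow)

lemma map_exp_euler:
  assumes X: "mps_nth X 0 = 0"
  shows "mps_map h (mps_exp (- X) * mps_euler (mps_exp X))
    = mps_exp (- mps_map h X) * mps_euler (mps_exp (mps_map h X))"
  by (simp add: mps_exp_euler X mps_nth_map map_sum map_scaleQ map_comm_op_funpow map_euler
      del: fact_Suc)

text \<open>Both sides have constant term 1 and solve D f = f V with the same V, because V is built
  from iterated commutators and can be computed before applying \<open>h\<close>. This takes the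
  place of the Baker-Campbell-Hausdorff formula.\<close>

lemma exp_map_mult:
  assumes X: "mps_nth X 0 = 0" and Y: "mps_nth Y 0 = 0" and W: "mps_nth W 0 = 0"
    and eq: "mps_exp W = mps_exp X * mps_exp Y"
  shows "mps_exp (mps_map h W) = mps_exp (mps_map h X) * mps_exp (mps_map h Y)"
proof -
  let ?X = "mps_map h X" and ?Y = "mps_map h Y" and ?W = "mps_map h W"
  have nth0: "mps_nth ?X 0 = 0" "mps_nth ?Y 0 = 0" "mps_nth ?W 0 = 0"
    by (simp_all add: mps_nth_map X Y W)
  define P where "P = mps_exp ?X * mps_exp ?Y"
  have eq': "mps_exp (- W) = mps_exp (- Y) * mps_exp (- X)"
  proof -
    have "mps_exp (- Y) * mps_exp (- X) * mps_exp W
        = mps_exp (- Y) * (mps_exp (- X) * mps_exp X) * mps_exp Y"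
      by (simp add: eq mult.assoc)
    then have "mps_exp (- Y) * mps_exp (- X) * mps_exp W = 1"
      by (simp add: mps_exp_inverse_left X Y)
    then have "mps_exp (- Y) * mps_exp (- X) * (mps_exp W * mps_exp (- W)) = mps_exp (- W)"
      by (simp flip: mult.assoc)
    then show ?thesis by (simp add: mps_exp_inverse_right W)
  qed
  \<comment> \<open>The logarithmic derivative of the left side of the claim.\<close>
  define V where "V = mps_exp (- ?W) * mps_euler (mps_exp ?W)"
  have "V = mps_map h (mps_exp (- W) * mps_euler (mps_exp W))"
    by (simp add: V_def map_exp_euler W)
  \<comment> \<open>Leibniz rule for the product exp X exp Y: the logarithmic derivative of the
    first factor is conjugated by the second. Each ingredient is of a kind that \<open>h\<close>
    transports.\<close>
  also have "mps_exp (- W) * mps_euler (mps_exp W)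
      = mps_exp (- Y) * (mps_exp (- X) * mps_euler (mps_exp X) * mps_exp Y)
      + mps_exp (- Y) * (mps_exp (- X) * mps_exp X) * mps_euler (mps_exp Y)"
    by (simp add: eq eq' mps_euler_mult distrib_left mult.assoc)
  also have "mps_map h \<dots> = mps_exp (- ?Y) * (mps_exp (- ?X) * mps_euler (mps_exp ?X) * mps_exp ?Y)
      + mps_exp (- ?Y) * mps_euler (mps_exp ?Y)"
    by (simp add: map_add mps_exp_inverse_left map_exp_conj map_exp_euler X Y)
  finally have V: "V = mps_exp (- ?Y) * (mps_exp (- ?X) * mps_euler (mps_exp ?X) * mps_exp ?Y)
      + mps_exp (- ?Y) * mps_euler (mps_exp ?Y)" .
  have "P * V = mps_exp ?X * (mps_exp ?Y * mps_exp (- ?Y)) * mps_exp (- ?X) * mps_euler (mps_exp ?X) * mps_exp ?Y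
      + mps_exp ?X * (mps_exp ?Y * mps_exp (- ?Y)) * mps_euler (mps_exp ?Y)"
    by (simp add: P_def V distrib_left mult.assoc)
  then have PV: "mps_euler P = P * V"
    by (simp add: nth0 mps_exp_inverse_right P_def mps_euler_mult)
  have "mps_exp ?W * V = mps_exp ?W * mps_exp (- ?W) * mps_euler (mps_exp ?W)"
    by (simp add: V_def mult.assoc)
  then have WV: "mps_euler (mps_exp ?W) = mps_exp ?W * V"
    by (simp add: nth0 mps_exp_inverse_right)
  have "mps_exp ?W - P = 0"
  proof (rule mps_euler_unique)
    show "mps_euler (mps_exp ?W - P) = (mps_exp ?W - P) * V"
      by (simp add: mps_euler_diff PV WV left_diff_distrib)
    show "mps_nth V 0 = 0" by (simp add: V_def mps_nth_euler_0)
    show "mps_nth (mps_exp ?W - P) 0 = 0"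
      by (simp add: P_def mps_nth_simps(4) mps_exp_nth_0 nth0)
  qed
  then show ?thesis by (simp add: P_def)
qed

lemma exp_map_log_mult:
  assumes "mps_nth F 0 = 1" "mps_nth G 0 = 1"
  shows "mps_exp (mps_map h (mps_log (F * G)))
    = mps_exp (mps_map h (mps_log F)) * mps_exp (mps_map h (mps_log G))"
  by (rule exp_map_mult) (simp_all add: assms mps_log_nth_0 mps_exp_log)

end

section \<open>Substitutions and infinite products\<close>

lemma uea_of_add: "uea_of (x + y) = uea_of x + uea_of y"
  by transfer (rule tsideal.gen, auto simp: uea_rels_def diff_diff_eq[symmetric])

lemma uea_of_scaleQ: "uea_of (c *\<^sub>Q x) = c *\<^sub>Q uea_of x"
  by transfer (rule tsideal.gen, auto simp: uea_rels_def)

lemma uea_of_commutator: "uea_of x * uea_of y - uea_of y * uea_of x = uea_of (x * y - y * x)"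
  by transfer (rule tsideal.gen, auto simp: uea_rels_def)

lemma itensor_at_add: "i \<ge> 1 \<Longrightarrow> itensor_at i (x + y) = itensor_at i x + itensor_at i y"
  by transfer (rule tsideal.gen, auto simp: itensor_rels_def diff_diff_eq[symmetric])

lemma itensor_at_scaleQ: "i \<ge> 1 \<Longrightarrow> itensor_at i (c *\<^sub>Q x) = c *\<^sub>Q itensor_at i x"
  by transfer (rule tsideal.gen, simp add: itensor_rels_def rscale_def mult_single, blast)

lemma pure_upd_mult: "pure_upd 0 i x + pure_upd 0 i y = pure_upd 0 i (x * y)"
  by transfer auto

lemma pure_upd_commute: "i \<noteq> j \<Longrightarrow> pure_upd 0 i x + pure_upd 0 j y = pure_upd 0 j y + pure_upd 0 i x"
  by transfer auto

lemma itensor_at_mult: "itensor_at i (x * y) = itensor_at i x * itensor_at i y"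
  by transfer (rule tsideal_eqI, simp add: mult_single pure_upd_mult)

lemma itensor_at_commute: "i \<noteq> j \<Longrightarrow> itensor_at i x * itensor_at j y = itensor_at j y * itensor_at i x"
  by transfer (rule tsideal_eqI, simp add: mult_single pure_upd_commute)

text \<open>At index 0 \<open>pure_upd\<close> changes nothing, so \<open>T 0\<close> is constantly
  1; hence the restriction to positive \<open>l\<close>.\<close>

lemma lie_hom_T: "l \<ge> 1 \<Longrightarrow> lie_hom (T l)"
proof
  fix x y :: "'r::{ring, monoid_mult} ratext" and c
  assume l: "l \<ge> 1"
  show add: "T l (x + y) = T l x + T l y" for x y :: "'r ratext"
    by (simp add: T_def uea_of_add itensor_at_add[OF l])
  show "T l (c *\<^sub>Q x) = c *\<^sub>Q T l x"
    by (simp add: T_def uea_of_scaleQ itensor_at_scaleQ[OF l])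
  have "itensor_at l (u - v) = itensor_at l u - itensor_at l v" for u v :: "'r ratext uea"
    using itensor_at_add[OF l, of "u - v" v] by (simp add: eq_diff_eq)
  then show "T l (x * y - y * x) = T l x * T l y - T l y * T l x"
    by (simp add: T_def itensor_at_mult flip: uea_of_commutator)
qed

lemma T_commute: "i \<noteq> j \<Longrightarrow> T i x * T j y = T j y * T i x"
  by (simp add: T_def itensor_at_commute)

lemma ratext_of_add: "ratext_of (x + y) = ratext_of x + ratext_of y"
  by transfer (rule tsideal.gen, auto simp: ratext_rels_def diff_diff_eq[symmetric])

lemma ratext_of_mult: "ratext_of (x * y) = ratext_of x * ratext_of y"
  by transfer (rule tsideal_eqI, simp add: mult_single)

lemma ratext_of_1: "ratext_of 1 = 1"
  by transfer (rule tsideal_eqI, simp flip: single_one add: zero_multmon_def)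

lemma ratext_of_0: "ratext_of 0 = 0"
  using ratext_of_add[of 0 0] by simp

lemma ratext_of_minus: "ratext_of (- x) = - ratext_of x"
  using ratext_of_add[of x "- x"] by (simp add: ratext_of_0 eq_neg_iff_add_eq_0 add.commute)

lemma ratext_of_sum: "ratext_of (\<Sum>i\<in>I. f i) = (\<Sum>i\<in>I. ratext_of (f i))"
  by (induction I rule: infinite_finite_induct) (simp_all add: ratext_of_0 ratext_of_add)

text \<open>The substitution sending x^m to \<open>\<chi> m\<close> times
  x^(\<open>\<phi> m\<close>). A zero weight allows variables to be set to 0; finite fibers make it
  well defined on infinite series, and the degree bound makes it respect
  \<open>vanish\<close>.\<close>

locale mps_substitution =
  fixes \<phi> :: "('v \<Rightarrow>\<^sub>0 nat) \<Rightarrow> ('w \<Rightarrow>\<^sub>0 nat)" and \<chi> :: "('v \<Rightarrow>\<^sub>0 nat) \<Rightarrow> rat"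
  assumes phi_0: "\<phi> 0 = 0" and phi_add: "\<phi> (a + b) = \<phi> a + \<phi> b"
    and chi_0: "\<chi> 0 = 1" and chi_add: "\<chi> (a + b) = \<chi> a * \<chi> b"
    and finite_fiber: "finite {m. \<chi> m \<noteq> 0 \<and> \<phi> m = n}"
    and mdeg_le: "\<chi> m \<noteq> 0 \<Longrightarrow> mdeg m \<le> mdeg (\<phi> m)"
begin

abbreviation "fiber n \<equiv> {m. \<chi> m \<noteq> 0 \<and> \<phi> m = n}"

definition msub :: "('v, 'a::rat_algebra) mps \<Rightarrow> ('w, 'a) mps" where
  "msub f = Abs_mps (\<lambda>n. \<Sum>m\<in>fiber n. \<chi> m *\<^sub>Q mps_nth f m)"

lemma mps_nth_msub: "mps_nth (msub f) n = (\<Sum>m\<in>fiber n. \<chi> m *\<^sub>Q mps_nth f m)"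
  by (simp add: msub_def)

lemma fiber_0: "fiber 0 = {0}"
  using mdeg_le phi_0 chi_0 by fastforce

lemma mps_nth_msub_0: "mps_nth (msub f) 0 = mps_nth f 0"
  by (simp add: mps_nth_msub fiber_0 chi_0 scaleQ_one)

lemma msub_1: "msub 1 = 1"
proof (rule mps_eqI)
  fix n
  show "mps_nth (msub 1) n = mps_nth 1 n"
  proof (cases "n = 0")
    case True
    then show ?thesis by (simp add: mps_nth_msub_0 one_mps.rep_eq)
  next
    case False
    then have "0 \<notin> fiber n" by (auto simp: phi_0)
    then have "mps_nth (msub 1) n = 0"
      unfolding mps_nth_msub one_mps.rep_eq by (intro sum.neutral ballI) auto
    then show ?thesis by (simp add: False one_mps.rep_eq)
  qed
qed

lemma msub_add: "msub (f + g) = msub f + msub g"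
  by (rule mps_eqI) (simp add: mps_nth_msub mps_nth_simps scaleQ_add_right sum.distrib)

lemma msub_diff: "msub (f - g) = msub f - msub g"
  by (rule mps_eqI) (simp add: mps_nth_msub mps_nth_simps scaleQ_diff_right sum_subtractf)

lemma msub_scaleQ: "msub (c *\<^sub>Q f) = c *\<^sub>Q msub f"
  by (rule mps_eqI) (simp add: mps_nth_msub mps_nth_scaleQ scaleQ_sum_right scaleQ_scaleQ mult.commute)

lemma msub_mult: "msub (f * g) = msub f * msub g"
proof (rule mps_eqI)
  fix n
  let ?S = "\<lambda>a b. \<chi> a *\<^sub>Q mps_nth f a * \<chi> b *\<^sub>Q mps_nth g b"
  have "mps_nth (msub (f * g)) n = (\<Sum>m\<in>fiber n. \<Sum>p\<in>splittings m. ?S (fst p) (snd p))"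
    unfolding mps_nth_msub times_mps.rep_eq scaleQ_sum_right case_prod_unfold
    by (intro sum.cong refl) (auto simp: splittings_def chi_add scaleQ_simps mult.commute)
  also have "\<dots> = (\<Sum>(m, p)\<in>Sigma (fiber n) splittings. ?S (fst p) (snd p))"
    by (rule sum.Sigma) (auto simp: finite_fiber finite_splittings)
  \<comment> \<open>Pairs (a, b) are regrouped by their images under \<open>\<phi>\<close>; the
    weight of a + b is nonzero exactly when both weights are.\<close>
  also have "\<dots> = (\<Sum>(q, p)\<in>(SIGMA q:splittings n. fiber (fst q) \<times> fiber (snd q)). ?S (fst p) (snd p))"
    by (rule sum.reindex_bij_witness
          [where j = "\<lambda>(m, (a, b)). ((\<phi> a, \<phi> b), (a, b))" and i = "\<lambda>(q, (a, b)). (a + b, (a, b))"])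
       (auto simp: splittings_def chi_add phi_add)
  also have "\<dots> = (\<Sum>q\<in>splittings n. \<Sum>p\<in>fiber (fst q) \<times> fiber (snd q). ?S (fst p) (snd p))"
    by (rule sum.Sigma[symmetric]) (auto simp: finite_fiber finite_splittings)
  also have "\<dots> = mps_nth (msub f * msub g) n"
    by (simp add: times_mps.rep_eq mps_nth_msub sum_product sum.cartesian_product case_prod_unfold)
  finally show "mps_nth (msub (f * g)) n = mps_nth (msub f * msub g) n" .
qed

lemma msub_power: "msub (f ^ n) = msub f ^ n"
  by (induction n) (simp_all add: msub_1 msub_mult)

lemma msub_prod_list: "msub (prod_list fs) = prod_list (map msub fs)"
  by (induction fs) (simp_all add: msub_1 msub_mult)

lemma vanish_msub: "vanish k f \<Longrightarrow> vanish k (msub f)"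
  unfolding vanish_def mps_nth_msub
  by (intro allI impI sum.neutral) (use mdeg_le in fastforce)

lemma msub_sum:
  assumes X: "\<And>n. vanish n (X n)"
  shows "msub (mps_sum X) = mps_sum (\<lambda>n. msub (X n))"
proof (rule mps_eqI)
  fix n
  have "mps_nth (msub (mps_sum X)) n = (\<Sum>m\<in>fiber n. \<Sum>k\<le>mdeg n. \<chi> m *\<^sub>Q mps_nth (X k) m)"
    unfolding mps_nth_msub scaleQ_sum_right[symmetric]
    using mdeg_le by (intro sum.cong refl arg_cong2[of _ _ _ _ scaleQ] mps_nth_mps_sum X) auto
  also have "\<dots> = (\<Sum>k\<le>mdeg n. mps_nth (msub (X k)) n)"
    unfolding mps_nth_msub by (rule sum.swap)
  finally show "mps_nth (msub (mps_sum X)) n = mps_nth (mps_sum (\<lambda>n. msub (X n))) n"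
    by (simp add: mps_sum_def)
qed

lemma msub_fps_eval: "mps_nth Y 0 = 0 \<Longrightarrow> msub (fps_eval f Y) = fps_eval f (msub Y)"
  by (simp add: fps_eval_def msub_sum vanish_fps_eval msub_scaleQ msub_power)

lemma msub_exp: "mps_nth X 0 = 0 \<Longrightarrow> msub (mps_exp X) = mps_exp (msub X)"
  by (simp add: mps_exp_eq_fps_eval mps_nth_msub_0 msub_fps_eval)

lemma msub_log:
  assumes F: "mps_nth F 0 = 1"
  shows "msub (mps_log F) = mps_log (msub F)"
proof -
  have "mps_nth (F - 1) 0 = 0" by (simp add: F mps_nth_simps)
  then show ?thesis
    using F by (simp add: mps_log_eq_fps_eval mps_nth_msub_0 msub_fps_eval msub_diff msub_1)
qed

lemma msub_map:
  assumes "lie_hom h"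
  shows "msub (mps_map h f) = mps_map h (msub f)"
  using assms by (intro mps_eqI) (simp add: mps_nth_map mps_nth_msub lie_hom.sum lie_hom.scaleQ)

lemma msub_Theta:
  assumes "l \<ge> 1" "mps_nth F 0 = 1"
  shows "msub (Theta l F) = Theta l (msub F)"
proof -
  interpret lie_hom "T l" using assms by (rule_tac lie_hom_T)
  show ?thesis
    using assms unfolding Theta_def
    by (simp add: msub_exp mps_nth_map mps_log_nth_0 msub_map[OF lie_hom_axioms] msub_log)
qed

end

section \<open>Products of Theta series and infinite products\<close>

lemma Theta_mult:
  assumes "l \<ge> 1" "mps_nth F 0 = 1" "mps_nth G 0 = 1"
  shows "Theta l (F * G) = Theta l F * Theta l G"
  unfolding Theta_def using assms by (intro lie_hom.exp_map_log_mult lie_hom_T)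

lemma mps_exp_commute:
  assumes XY: "X * Y = Y * X" and X: "mps_nth X 0 = 0" and Y: "mps_nth Y 0 = 0"
  shows "mps_exp X * mps_exp Y = mps_exp Y * mps_exp X"
proof -
  have "Z * dpower W n = dpower W n * Z" if "Z * W = W * Z" for Z W :: "('a, 'b) mps" and n
    using that by (simp add: dpower_def scaleQ_simps power_commuting_commutes)
  note c = this
  have "Z * mps_exp W = mps_exp W * Z" if "Z * W = W * Z" "mps_nth W 0 = 0" for Z W :: "('a, 'b) mps"
    using that by (simp add: mps_exp_eq mps_sum_mult_left mps_sum_mult_right vanish_dpower c)
  then show ?thesis using assms by metis
qed

text \<open>The two exponents have coefficients in different tensor factors, so they
  commute.\<close>

lemma Theta_commute:
  fixes F G :: "('v, 'r::{ring, monoid_mult} ratext) mps"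
  assumes ij: "i \<ge> 1" "j \<ge> 1" "i \<noteq> j" and F: "mps_nth F 0 = 1" and G: "mps_nth G 0 = 1"
  shows "Theta i F * Theta j G = Theta j G * Theta i F"
  unfolding Theta_def
proof (rule mps_exp_commute)
  interpret i: lie_hom "T i" using ij by (rule_tac lie_hom_T)
  interpret j: lie_hom "T j" using ij by (rule_tac lie_hom_T)
  show "mps_nth (mps_map (T i) (mps_log F)) 0 = 0" "mps_nth (mps_map (T j) (mps_log G)) 0 = 0"
    by (simp_all add: mps_nth_map mps_log_nth_0 F G)
  have "comm_op (mps_map (T i) f) (mps_map (T j) g) = 0" for f g :: "('v, 'r ratext) mps"
    by (rule mps_eqI) (simp add: mps_nth_comm_op mps_nth_map T_commute[OF ij(3)] zero_mps.rep_eq)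
  then show "mps_map (T i) (mps_log F) * mps_map (T j) (mps_log G)
      = mps_map (T j) (mps_log G) * mps_map (T i) (mps_log F)"
    by (simp add: comm_op_def)
qed

text \<open>Every term of f(Y) - f(0) contains a factor \<open>Y\<close>.\<close>

lemma vanish_fps_eval_diff:
  fixes Y :: "('v, 'a::rat_algebra) mps"
  assumes "vanish l Y" "l \<ge> 1"
  shows "vanish l (fps_eval f Y - fps_nth f 0 *\<^sub>Q 1)"
  unfolding vanish_def
proof (intro allI impI)
  fix m :: "'v \<Rightarrow>\<^sub>0 nat" assume m: "mdeg m < l"
  have Y: "mps_nth Y 0 = 0" using assms by (simp add: vanish_def)
  have "mps_nth (fps_eval f Y) m = (\<Sum>n\<le>Suc (mdeg m). fps_nth f n *\<^sub>Q mps_nth (Y ^ n) m)"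
    by (rule fps_eval_nth[OF Y]) simp
  also have "\<dots> = fps_nth f 0 *\<^sub>Q mps_nth 1 m"
    using vanishD[OF vanish_mult_right[OF assms(1)] m]
    unfolding sum.atMost_Suc_shift by simp
  finally show "mps_nth (fps_eval f Y - fps_nth f 0 *\<^sub>Q 1) m = 0"
    by (simp add: minus_mps.rep_eq mps_nth_scaleQ)
qed

lemma nth_0_of_vanish: "vanish l (F - 1) \<Longrightarrow> l \<ge> 1 \<Longrightarrow> mps_nth F 0 = (1 :: 'a::{ring, monoid_mult})"
  using vanishD[of l "F - 1" 0] by (simp add: mps_nth_simps)

lemma vanish_Theta:
  assumes F: "vanish l (F - 1)" and l: "l \<ge> 1"
  shows "vanish l (Theta l F - 1)"
proof -
  interpret lie_hom "T l" using l by (rule lie_hom_T)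
  note F0 = nth_0_of_vanish[OF F l]
  have "vanish l (mps_log F)"
    using vanish_fps_eval_diff[OF F l, of "fps_ln 1"] by (simp add: mps_log_eq_fps_eval[OF F0])
  then have "vanish l (mps_map (T l) (mps_log F))"
    by (simp add: vanish_def mps_nth_map)
  from vanish_fps_eval_diff[OF this l, of "fps_exp 1"] show ?thesis
    by (simp add: Theta_def mps_exp_eq_fps_eval mps_nth_map mps_log_nth_0 F0 scaleQ_one)
qed

text \<open>The factor with index \<open>l\<close> agrees with 1 below degree \<open>l\<close>, so
  factors beyond \<open>N\<close> do not affect coefficients of degree at most
  \<open>N\<close>.\<close>

lemma mps_nth_infprod:
  fixes F :: "nat \<Rightarrow> ('v, 'a::{ring, monoid_mult}) mps"
  assumes F: "\<And>l. l \<ge> 1 \<Longrightarrow> vanish l (F l - 1)" and N: "mdeg m \<le> N"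
  shows "mps_nth (mps_infprod F) m = mps_nth (prod_list (map F [1..<Suc N])) m"
proof -
  let ?P = "\<lambda>L. prod_list (map F [1..<Suc L])"
  have stable: "mps_nth (?P L) m = mps_nth (?P N) m" if "N \<le> L" for L
    using that
  proof (induction L rule: dec_induct)
    case (step L)
    have "vanish (Suc L) (?P L * (F (Suc L) - 1))"
      by (rule vanish_mult_left) (simp add: F)
    then have "mps_nth (?P L * (F (Suc L) - 1)) m = 0"
      using N step by (intro vanishD) auto
    then have "mps_nth (?P (Suc L)) m = mps_nth (?P L) m"
      by (simp add: right_diff_distrib minus_mps.rep_eq)
    then show ?case using step by simp
  qed simp
  have "(THE c. \<forall>\<^sub>F L in sequentially. mps_nth (?P L) m = c) = mps_nth (?P N) m"
  proof (rule the_equality)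
    show ev: "\<forall>\<^sub>F L in sequentially. mps_nth (?P L) m = mps_nth (?P N) m"
      using stable by (rule eventually_sequentiallyI)
    fix c assume "\<forall>\<^sub>F L in sequentially. mps_nth (?P L) m = c"
    with ev have "\<forall>\<^sub>F L in sequentially. c = mps_nth (?P N) m"
      by eventually_elim simp
    then show "c = mps_nth (?P N) m" by simp
  qed
  then show ?thesis by (simp add: mps_infprod_def)
qed

lemma mps_nth_mult_cong:
  fixes f g :: "('v, 'a::ring) mps"
  assumes "\<And>k. mdeg k \<le> mdeg m \<Longrightarrow> mps_nth f k = mps_nth f' k"
    and "\<And>k. mdeg k \<le> mdeg m \<Longrightarrow> mps_nth g k = mps_nth g' k"
  shows "mps_nth (f * g) m = mps_nth (f' * g') m"
  unfolding times_mps.rep_eq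
  by (intro sum.cong refl) (auto dest!: mdeg_splittings simp: assms)

lemma mps_infprod_mult:
  fixes F G :: "nat \<Rightarrow> ('v, 'a::{ring, monoid_mult}) mps"
  assumes F: "\<And>l. l \<ge> 1 \<Longrightarrow> vanish l (F l - 1)" and G: "\<And>l. l \<ge> 1 \<Longrightarrow> vanish l (G l - 1)"
    and comm: "\<And>i j. i \<ge> 1 \<Longrightarrow> j \<ge> 1 \<Longrightarrow> i \<noteq> j \<Longrightarrow> F i * G j = G j * F i"
  shows "mps_infprod (\<lambda>l. F l * G l) = mps_infprod F * mps_infprod G"
proof (rule mps_eqI)
  fix m :: "'v \<Rightarrow>\<^sub>0 nat"
  have FG: "vanish l (F l * G l - 1)" if "l \<ge> 1" for l
  proof -
    have eq: "F l * G l - 1 = F l * (G l - 1) + (F l - 1)" by (simp add: right_diff_distrib)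
    show ?thesis unfolding eq by (intro vanish_add vanish_mult_left F G that)
  qed
  \<comment> \<open>A later factor of \<open>F\<close> can be moved to the left past all earlier
    factors of \<open>G\<close>, which is what the interleaved product requires.\<close>
  have c: "prod_list (map G [1..<Suc L]) * F j = F j * prod_list (map G [1..<Suc L])" if "L < j" for L j
    using that
  proof (induction L)
    case (Suc L)
    have "prod_list (map G [1..<Suc (Suc L)]) * F j = prod_list (map G [1..<Suc L]) * (F j * G (Suc L))"
      using Suc.prems by (simp add: mult.assoc comm)
    also have "\<dots> = F j * prod_list (map G [1..<Suc L]) * G (Suc L)"
      using Suc by (simp flip: mult.assoc)
    finally show ?case by (simp add: mult.assoc)
  qed simp
  have P: "prod_list (map (\<lambda>l. F l * G l) [1..<Suc L])
      = prod_list (map F [1..<Suc L]) * prod_list (map G [1..<Suc L])" for L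
  proof (induction L)
    case (Suc L)
    let ?F = "prod_list (map F [1..<Suc L])" and ?G = "prod_list (map G [1..<Suc L])"
    have "prod_list (map (\<lambda>l. F l * G l) [1..<Suc (Suc L)]) = ?F * (?G * F (Suc L)) * G (Suc L)"
      by (simp add: Suc[simplified] mult.assoc)
    then show ?case by (simp add: c[simplified] mult.assoc)
  qed simp
  show "mps_nth (mps_infprod (\<lambda>l. F l * G l)) m = mps_nth (mps_infprod F * mps_infprod G) m"
  proof (subst mps_nth_infprod[where N = "mdeg m"])
    show "mps_nth (prod_list (map (\<lambda>l. F l * G l) [1..<Suc (mdeg m)])) m
        = mps_nth (mps_infprod F * mps_infprod G) m"
      unfolding P by (rule mps_nth_mult_cong) (simp_all only: mps_nth_infprod[OF F] mps_nth_infprod[OF G])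
  qed (simp_all only: FG order.refl)
qed

text \<open>Exponents in the fiber over \<open>n\<close> have degree at most \<open>mdeg n\<close>,
  so one finite partial product computes all the coefficients involved.\<close>

lemma (in mps_substitution) msub_infprod:
  assumes F: "\<And>l. l \<ge> 1 \<Longrightarrow> vanish l (F l - 1)"
  shows "msub (mps_infprod F) = mps_infprod (\<lambda>l. msub (F l))"
proof (rule mps_eqI)
  fix n
  have F': "vanish l (msub (F l) - 1)" if "l \<ge> 1" for l
    using vanish_msub[OF F[OF that]] by (simp add: msub_diff msub_1)
  have "mps_nth (msub (mps_infprod F)) n
      = (\<Sum>m\<in>fiber n. \<chi> m *\<^sub>Q mps_nth (prod_list (map F [1..<Suc (mdeg n)])) m)"
    unfolding mps_nth_msub
    using mdeg_le by (intro sum.cong refl arg_cong2[of _ _ _ _ scaleQ] mps_nth_infprod F) auto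
  also have "\<dots> = mps_nth (prod_list (map (\<lambda>l. msub (F l)) [1..<Suc (mdeg n)])) n"
    by (simp only: msub_prod_list mps_nth_msub[symmetric] map_map o_def)
  also have "\<dots> = mps_nth (mps_infprod (\<lambda>l. msub (F l))) n"
    by (rule mps_nth_infprod[symmetric, OF F' order.refl])
  finally show "mps_nth (msub (mps_infprod F)) n = mps_nth (mps_infprod (\<lambda>l. msub (F l))) n" .
qed

section \<open>The multiplicative map behind the series \<open>E\<^sub>U\<close>\<close>

definition nscale :: "nat \<Rightarrow> ('v \<Rightarrow>\<^sub>0 nat) \<Rightarrow> ('v \<Rightarrow>\<^sub>0 nat)" where
  "nscale l m = Poly_Mapping.map ((*) l) m"

lemma lookup_nscale [simp]: "Poly_Mapping.lookup (nscale l m) v = l * Poly_Mapping.lookup m v"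
  by (simp add: nscale_def map.rep_eq when_def)

lemma nscale_add_right: "nscale l (a + b) = nscale l a + nscale l b"
  by (rule poly_mapping_eqI) (simp add: lookup_add distrib_left)

lemma nscale_add_left: "nscale (k + l) a = nscale k a + nscale l a"
  by (rule poly_mapping_eqI) (simp add: lookup_add distrib_right)

lemma nscale_0_left [simp]: "nscale 0 a = 0"
  by (rule poly_mapping_eqI) simp

lemma nscale_0_right [simp]: "nscale l 0 = 0"
  by (rule poly_mapping_eqI) simp

lemma nscale_Suc: "nscale (Suc l) a = a + nscale l a"
  by (rule poly_mapping_eqI) (simp add: lookup_add)

lemma mdeg_nscale [simp]: "mdeg (nscale l m) = l * mdeg m"
  by (induction l) (simp_all add: nscale_Suc)

lemma nscale_cancel: "l \<noteq> 0 \<Longrightarrow> nscale l a = nscale l b \<longleftrightarrow> a = b"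
  by (auto simp: poly_mapping_eq_iff fun_eq_iff)

lemma mps_monom_mult:
  "mps_monom a x * mps_monom b y = mps_monom (a + b) (x * y :: 'a::{ring})"
proof (rule mps_eqI)
  fix m
  have "mps_nth (mps_monom a x * mps_monom b y) m
      = (\<Sum>p\<in>splittings m. if p = (a, b) then x * y else 0)"
    unfolding times_mps.rep_eq by (intro sum.cong) (auto simp: mps_nth_monom split: if_splits)
  then show "mps_nth (mps_monom a x * mps_monom b y) m = mps_nth (mps_monom (a + b) (x * y)) m"
    by (simp add: mps_nth_monom finite_splittings) (auto simp: splittings_def)
qed

lemma mps_monom_power:
  "mps_monom a x ^ n = mps_monom (nscale n a) (x ^ n :: 'a::{ring, monoid_mult})"
proof (induction n)
  case 0
  show ?case by (rule mps_eqI) (simp add: mps_nth_monom one_mps.rep_eq)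
next
  case (Suc n)
  then show ?case by (simp add: mps_monom_mult nscale_Suc)
qed

lemma (in mps_substitution) msub_monom:
  "msub (mps_monom k a) = mps_monom (\<phi> k) (\<chi> k *\<^sub>Q a)"
proof (rule mps_eqI)
  fix n
  have "mps_nth (msub (mps_monom k a)) n = (\<Sum>m\<in>fiber n. if m = k then \<chi> k *\<^sub>Q a else 0)"
    unfolding mps_nth_msub by (intro sum.cong) (auto simp: mps_nth_monom)
  then show "mps_nth (msub (mps_monom k a)) n = mps_nth (mps_monom (\<phi> k) (\<chi> k *\<^sub>Q a)) n"
    using finite_fiber[of n] by (auto simp: mps_nth_monom)
qed

abbreviation adams_sign :: "nat \<Rightarrow> ('v \<Rightarrow>\<^sub>0 nat) \<Rightarrow> rat" where
  "adams_sign l m \<equiv> (- 1) ^ (l * mdeg m)"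

lemma mps_substitution_adams:
  assumes "l \<ge> 1"
  shows "mps_substitution (nscale l) (adams_sign l)"
proof
  fix n :: "'a \<Rightarrow>\<^sub>0 nat"
  have "inj (nscale l :: ('a \<Rightarrow>\<^sub>0 nat) \<Rightarrow> _)"
    using assms by (auto simp: inj_def nscale_cancel)
  from finite_inverse_image[OF _ this, of "{n}"]
  show "finite {m. adams_sign l m \<noteq> 0 \<and> nscale l m = n}" by simp
  show "mdeg n \<le> mdeg (nscale l n)" using assms by simp
qed (simp_all add: nscale_add_right distrib_left power_add)

text \<open>Only the exponents are scaled, never the coefficients, so this stays multiplicative over
  a noncommutative ring. The sign is that of (-t)^l in \<open>Eseries\<close>: for a monomial x^k of
  degree 1, \<open>adams l\<close> sends 1 - x^k U to 1 - (-1)^l x^(l k) U.\<close>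

definition adams :: "nat \<Rightarrow> ('v, 'r::{ring, monoid_mult}) mps \<Rightarrow> ('v, 'r ratext) mps" where
  "adams l f = mps_substitution.msub (nscale l) (adams_sign l) (mps_map ratext_of f)"

definition Mseries :: "('v, 'r::{ring, monoid_mult}) mps \<Rightarrow> ('v, 'r ginf) mps" where
  "Mseries f = mps_infprod (\<lambda>l. Theta l (adams l f))"

lemma map_ratext_of_mult:
  "mps_map ratext_of (f * g) = mps_map ratext_of f * mps_map ratext_of g"
  by (rule mps_eqI)
     (simp add: mps_nth_map times_mps.rep_eq ratext_of_sum ratext_of_mult case_prod_unfold)

lemma adams_mult: "l \<ge> 1 \<Longrightarrow> adams l (f * g) = adams l f * adams l g"
  by (simp add: adams_def map_ratext_of_mult mps_substitution.msub_mult[OF mps_substitution_adams])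

lemma adams_nth_0: "l \<ge> 1 \<Longrightarrow> mps_nth (adams l f) 0 = ratext_of (mps_nth f 0)"
  by (simp add: adams_def mps_substitution.mps_nth_msub_0[OF mps_substitution_adams] mps_nth_map)

lemma vanish_adams:
  fixes f :: "('v, 'r::{ring, monoid_mult}) mps"
  assumes f: "mps_nth f 0 = 1" and l: "l \<ge> 1"
  shows "vanish l (adams l f - 1)"
  unfolding vanish_def
proof (intro allI impI)
  fix n :: "'v \<Rightarrow>\<^sub>0 nat" assume n: "mdeg n < l"
  interpret mps_substitution "nscale l" "adams_sign l" by (rule mps_substitution_adams[OF l])
  show "mps_nth (adams l f - 1) n = 0"
  proof (cases "n = 0")
    case True
    then show ?thesis by (simp add: adams_nth_0[OF l] f ratext_of_1 mps_nth_simps)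
  next
    case False
    have "nscale l m \<noteq> n" for m
    proof
      assume eq: "nscale l m = n"
      then have "l * mdeg m < l" using n by auto
      then have "m = 0" by simp
      with eq False show False by simp
    qed
    then show ?thesis using False
      by (simp add: adams_def mps_nth_msub mps_nth_simps)
  qed
qed

lemma vanish_Theta_adams:
  "mps_nth f 0 = 1 \<Longrightarrow> l \<ge> 1 \<Longrightarrow> vanish l (Theta l (adams l f) - 1)"
  by (intro vanish_Theta vanish_adams)

lemma mps_infprod_cong:
  assumes "\<And>l. l \<ge> 1 \<Longrightarrow> F l = G l"
  shows "mps_infprod F = mps_infprod G"
proof -
  have "map F [1..<Suc L] = map G [1..<Suc L]" for L
    by (intro map_cong refl assms) auto
  then show ?thesis by (simp only: mps_infprod_def)
qed

text \<open>\<open>adams l\<close> and \<open>Theta l\<close> are multiplicative for each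
  \<open>l\<close>, and factors with different \<open>l\<close> commute, so the two infinite
  products can be disentangled.\<close>

lemma Mseries_mult:
  assumes f: "mps_nth f 0 = 1" and g: "mps_nth g 0 = 1"
  shows "Mseries (f * g) = Mseries f * Mseries g"
proof -
  have 1: "mps_nth (adams l f) 0 = 1" "mps_nth (adams l g) 0 = 1" if "l \<ge> 1" for l
    using that by (simp_all add: adams_nth_0 f g ratext_of_1)
  have "Mseries (f * g) = mps_infprod (\<lambda>l. Theta l (adams l f) * Theta l (adams l g))"
    unfolding Mseries_def by (intro mps_infprod_cong) (simp add: adams_mult Theta_mult 1)
  also have "\<dots> = Mseries f * Mseries g"
    unfolding Mseries_def
    by (intro mps_infprod_mult vanish_Theta_adams f g Theta_commute 1)
  finally show ?thesis .
qed

text \<open>The geometric series gives an explicit two-sided inverse using only ring operations,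
  hence also over the integral ring \<open>R\<close>.\<close>

definition mps_geom :: "('v, 'a::{ring, monoid_mult}) mps \<Rightarrow> ('v, 'a) mps" where
  "mps_geom f = mps_sum (\<lambda>n. (1 - f) ^ n)"

lemma mps_geom_nth_0: "mps_nth (mps_geom f) 0 = 1"
  by (simp add: mps_geom_def mps_sum_def one_mps.rep_eq)

lemma mps_geom:
  assumes f: "mps_nth f 0 = 1"
  shows mps_mult_geom: "f * mps_geom f = 1" and mps_geom_mult: "mps_geom f * f = 1"
proof -
  define X where "X = 1 - f"
  have X: "vanish n (X ^ n)" for n
    by (rule vanish_power) (simp add: X_def f mps_nth_simps)
  have g: "mps_geom f = 1 + mps_sum (\<lambda>n. X ^ Suc n)" "mps_geom f = mps_sum (\<lambda>n. X ^ n)"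
    unfolding mps_geom_def X_def[symmetric] by (simp_all add: mps_sum_0_shift[OF X] del: power_Suc)
  have "X * mps_geom f = mps_geom f - 1"
    by (subst (2) g(1)) (simp add: g(2) mps_sum_mult_left[OF X])
  then show "f * mps_geom f = 1" by (simp add: X_def left_diff_distrib)
  have "mps_geom f * X = mps_geom f - 1"
    by (subst (2) g(1)) (simp add: g(2) mps_sum_mult_right[OF X] power_commutes)
  then show "mps_geom f * f = 1" by (simp add: X_def right_diff_distrib)
qed

lemma mps_inverse_eqI:
  assumes "f * g = 1" "g * f = 1"
  shows "mps_inverse f = g"
  unfolding mps_inverse_def
proof (rule the_equality)
  fix g' assume g': "f * g' = 1 \<and> g' * f = 1"
  have "g' = g' * (f * g)" by (simp add: assms)
  also have "\<dots> = g" by (simp add: g' flip: mult.assoc)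
  finally show "g' = g" .
qed (use assms in simp)

text \<open>By multiplicativity the value is idempotent; its constant term is 1, so it is invertible
  and must equal 1.\<close>

lemma Mseries_1: "Mseries (1 :: ('v, 'r::{ring, monoid_mult}) mps) = 1"
proof -
  let ?M = "Mseries (1 :: ('v, 'r) mps)"
  have 1: "mps_nth (1 :: ('v, 'r) mps) 0 = 1" by (simp add: one_mps.rep_eq)
  have "mps_nth ?M 0 = mps_nth (prod_list (map (\<lambda>l. Theta l (adams l (1 :: ('v, 'r) mps))) [1..<Suc 0])) 0"
    unfolding Mseries_def by (rule mps_nth_infprod[OF vanish_Theta_adams[OF 1]]) simp_all
  then have "mps_nth ?M 0 = 1" by (simp add: one_mps.rep_eq)
  then have inv: "mps_geom ?M * ?M = 1" by (rule mps_geom_mult)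
  have "mps_geom ?M * ?M * ?M = mps_geom ?M * ?M"
    using Mseries_mult[OF 1 1] by (simp add: mult.assoc)
  then show ?thesis by (simp add: inv)
qed

lemma mps_inverse_Mseries:
  assumes f: "mps_nth f 0 = 1"
  shows "mps_inverse (Mseries f) = Mseries (mps_geom f)"
  by (rule mps_inverse_eqI)
     (simp_all add: f mps_geom_nth_0 mps_mult_geom mps_geom_mult Mseries_1 flip: Mseries_mult)

section \<open>Substituting a monomial into \<open>Eseries\<close>\<close>

lemma unit_mono_eq: "Poly_Mapping.single () (mdeg m) = m"
proof (rule poly_mapping_eqI)
  fix v
  have "{x. Poly_Mapping.lookup m x \<noteq> 0} \<subseteq> {()}" by auto
  then have "mdeg m = (\<Sum>x\<in>{()}. Poly_Mapping.lookup m x)"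
    unfolding mdeg_def by (intro Sum_any.expand_superset) simp_all
  then show "Poly_Mapping.lookup (Poly_Mapping.single () (mdeg m)) v = Poly_Mapping.lookup m v"
    by simp
qed

lemma mps_substitution_unit:
  fixes k :: "'w \<Rightarrow>\<^sub>0 nat"
  assumes "k \<noteq> 0"
  shows "mps_substitution (\<lambda>m :: unit \<Rightarrow>\<^sub>0 nat. nscale (mdeg m) k) (\<lambda>m. e ^ mdeg m)"
proof
  have "mdeg k \<noteq> 0" using assms by simp
  then have deg: "mdeg m \<le> mdeg (nscale (mdeg m) k)" for m :: "unit \<Rightarrow>\<^sub>0 nat"
    by (cases "mdeg k") simp_all
  then show "mdeg m \<le> mdeg (nscale (mdeg m) k)" for m :: "unit \<Rightarrow>\<^sub>0 nat" .
  fix n :: "'w \<Rightarrow>\<^sub>0 nat"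
  have "m = Poly_Mapping.single () (mdeg m)" for m :: "unit \<Rightarrow>\<^sub>0 nat"
    by (simp add: unit_mono_eq)
  then have "{m. e ^ mdeg m \<noteq> 0 \<and> nscale (mdeg m) k = n} \<subseteq> Poly_Mapping.single () ` {..mdeg n}"
    using deg by (auto intro!: image_eqI)
  then show "finite {m :: unit \<Rightarrow>\<^sub>0 nat. e ^ mdeg m \<noteq> 0 \<and> nscale (mdeg m) k = n}"
    by (rule finite_subset) simp
qed (simp_all add: nscale_add_left power_add)

lemma mps_subst_monom:
  assumes k: "k \<noteq> 0"
  shows "mps_subst f (mps_monom k e)
    = mps_substitution.msub (\<lambda>m. nscale (mdeg m) k) (\<lambda>m. e ^ mdeg m) f"
proof (rule mps_eqI)
  fix n
  interpret mps_substitution "\<lambda>m :: unit \<Rightarrow>\<^sub>0 nat. nscale (mdeg m) k" "\<lambda>m. e ^ mdeg m"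
    using k by (rule mps_substitution_unit)
  define A where "A = {r. e ^ r \<noteq> 0 \<and> nscale r k = n}"
  have A: "A = mdeg ` fiber n"
    by (auto simp: A_def image_iff) (metis mdeg_single)
  have "mps_nth (mps_subst f (mps_monom k e)) n
      = Sum_any (\<lambda>r. (if nscale r k = n then e ^ r else 0) *\<^sub>Q mps_nth f (Poly_Mapping.single () r))"
    by (simp add: mps_subst_def mps_monom_power mps_nth_monom eq_commute[of n])
  also have "\<dots> = (\<Sum>r\<in>A. (if nscale r k = n then e ^ r else 0) *\<^sub>Q mps_nth f (Poly_Mapping.single () r))"
  proof (rule Sum_any.expand_superset)
    show "finite A" unfolding A by (intro finite_imageI finite_fiber)
  qed (auto simp: A_def simp del: power_eq_0_iff)
  also have "\<dots> = (\<Sum>r\<in>A. e ^ r *\<^sub>Q mps_nth f (Poly_Mapping.single () r))"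
    by (intro sum.cong) (auto simp: A_def)
  also have "\<dots> = (\<Sum>m\<in>fiber n. e ^ mdeg m *\<^sub>Q mps_nth f m)"
  proof (rule sum.reindex_cong[OF _ A])
    show "inj_on mdeg (fiber n)"
      by (rule inj_on_inverseI[of _ "Poly_Mapping.single ()"]) (rule unit_mono_eq)
  qed (simp add: unit_mono_eq)
  finally show "mps_nth (mps_subst f (mps_monom k e)) n = mps_nth (msub f) n"
    by (simp add: mps_nth_msub)
qed

lemma adams_one_minus_monom:
  assumes l: "l \<ge> 1"
  shows "adams l (1 - mps_monom k U)
    = 1 - mps_monom (nscale l k) (adams_sign l k *\<^sub>Q ratext_of U)"
proof -
  interpret mps_substitution "nscale l" "adams_sign l" by (rule mps_substitution_adams[OF l])
  have "mps_map ratext_of (1 - mps_monom k U) = 1 - mps_monom k (ratext_of U)"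
    using ratext_of_add[of 1 "- U"]
    by (intro mps_eqI) (simp add: mps_nth_map mps_nth_simps mps_nth_monom ratext_of_0 ratext_of_1 ratext_of_minus)
  then show ?thesis by (simp add: adams_def msub_diff msub_1 msub_monom)
qed

text \<open>The sign condition makes e^l (-1)^l equal to the sign in \<open>adams l\<close>. It
  gives e = 1 for monomials of degree 1, such as u and v, and e = -1 for uv, which accounts for the
  argument -uv of the theorem.\<close>

lemma mps_subst_Eseries:
  assumes k: "k \<noteq> 0" and e: "e = - ((- 1) ^ mdeg k)"
  shows "mps_subst (Eseries U) (mps_monom k e) = Mseries (1 - mps_monom k U)"
proof -
  interpret mps_substitution "\<lambda>m :: unit \<Rightarrow>\<^sub>0 nat. nscale (mdeg m) k" "\<lambda>m. e ^ mdeg m"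
    using k by (rule mps_substitution_unit)
  let ?F = "\<lambda>l. 1 - mps_monom (Poly_Mapping.single () l) ((- 1) ^ l *\<^sub>Q ratext_of U)"
  have F: "vanish l (?F l - 1)" for l
    by (auto simp: vanish_def mps_nth_simps mps_nth_monom)
  have F0: "mps_nth (?F l) 0 = 1" if "l \<ge> 1" for l
    by (rule nth_0_of_vanish[OF F that])
  have "mps_subst (Eseries U) (mps_monom k e) = msub (mps_infprod (\<lambda>l. Theta l (?F l)))"
    by (simp add: mps_subst_monom[OF k] Eseries_def)
  also have "\<dots> = mps_infprod (\<lambda>l. msub (Theta l (?F l)))"
    by (rule msub_infprod) (rule vanish_Theta[OF F])
  also have "\<dots> = mps_infprod (\<lambda>l. Theta l (adams l (1 - mps_monom k U)))"
  proof (rule mps_infprod_cong)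
    fix l :: nat assume l: "l \<ge> 1"
    have "e ^ l * (- 1) ^ l = ((- 1) ^ l) ^ mdeg k"
      by (simp add: e flip: power_mult_distrib power_mult) (simp add: mult.commute)
    then show "msub (Theta l (?F l)) = Theta l (adams l (1 - mps_monom k U))"
      by (simp add: msub_Theta[OF l F0[OF l]] msub_diff msub_1 msub_monom adams_one_minus_monom[OF l]
          scaleQ_scaleQ power_mult)
  qed
  finally show ?thesis by (simp add: Mseries_def)
qed

text \<open>Both q (1 - b a) p and p (1 - a b) q equal p + q - 1. The left side of the claim is a
  left inverse of this element and the right side a right inverse, so they coincide.\<close>

lemma inverse_identity:
  fixes a b :: "'a::{ring, monoid_mult}"
  assumes p: "(1 - a) * p = 1" "p * (1 - a) = 1" and q: "(1 - b) * q = 1" "q * (1 - b) = 1"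
    and x: "x * (1 - b * a) = 1" and y: "(1 - a * b) * y = 1"
  shows "(1 - a) * x * (1 - b) = (1 - b) * y * (1 - a)"
proof -
  have "q * (1 - b * a) * p = q * ((1 - b) + b * (1 - a)) * p"
    by (simp add: algebra_simps)
  also have "\<dots> = q * (1 - b) * p + q * b * ((1 - a) * p)"
    by (simp only: distrib_left distrib_right mult.assoc)
  also have "q * b = q - q * (1 - b)" by (simp add: right_diff_distrib)
  finally have W1: "q * (1 - b * a) * p = p + q - 1" by (simp add: p q add_diff_eq)
  have "p * (1 - a * b) * q = p * ((1 - a) + a * (1 - b)) * q"
    by (simp add: algebra_simps)
  also have "\<dots> = p * (1 - a) * q + p * a * ((1 - b) * q)"
    by (simp only: distrib_left distrib_right mult.assoc)
  also have "p * a = p - p * (1 - a)" by (simp add: right_diff_distrib)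
  finally have W2: "p * (1 - a * b) * q = p + q - 1" by (simp add: p q add_diff_eq)
  have "(1 - a) * x * (1 - b) * (p + q - 1) = (1 - a) * x * ((1 - b) * q) * (1 - b * a) * p"
    by (simp only: W1[symmetric] mult.assoc)
  also have "\<dots> = (1 - a) * (x * (1 - b * a)) * p" by (simp add: q mult.assoc)
  finally have L: "(1 - a) * x * (1 - b) * (p + q - 1) = 1" by (simp add: x p)
  have "(p + q - 1) * ((1 - b) * y * (1 - a)) = p * (1 - a * b) * (q * (1 - b)) * y * (1 - a)"
    by (simp only: W2[symmetric] mult.assoc)
  also have "\<dots> = p * ((1 - a * b) * y) * (1 - a)" by (simp add: q mult.assoc)
  finally have R: "(p + q - 1) * ((1 - b) * y * (1 - a)) = 1" by (simp add: y p)
  have "(1 - a) * x * (1 - b) = (1 - a) * x * (1 - b) * ((p + q - 1) * ((1 - b) * y * (1 - a)))"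
    by (simp add: R)
  also have "\<dots> = (1 - a) * x * (1 - b) * (p + q - 1) * ((1 - b) * y * (1 - a))"
    by (simp only: mult.assoc)
  finally show ?thesis by (simp add: L)
qed

section \<open>Polynomial dependence of coefficients\<close>

text \<open>A class of families in a parameter \<open>i\<close> that is closed under the algebra
  operations. It is used for two classes: pairs with equal components, giving a congruence rule, and
  polynomial sequences.\<close>

locale fun_subring =
  fixes C :: "('i \<Rightarrow> 'a::rat_algebra) set"
  assumes const: "(\<lambda>_. a) \<in> C"
    and add: "f \<in> C \<Longrightarrow> g \<in> C \<Longrightarrow> (\<lambda>i. f i + g i) \<in> C"
    and mult: "f \<in> C \<Longrightarrow> g \<in> C \<Longrightarrow> (\<lambda>i. f i * g i) \<in> C"
begin

lemma sum: "(\<And>x. x \<in> X \<Longrightarrow> f x \<in> C) \<Longrightarrow> (\<lambda>i. \<Sum>x\<in>X. f x i) \<in> C"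
  by (induction X rule: infinite_finite_induct) (auto simp: const add)

lemma scaleQ: "f \<in> C \<Longrightarrow> (\<lambda>i. c *\<^sub>Q f i) \<in> C"
  using mult[OF const, of f "c *\<^sub>Q 1"] by (simp add: scaleQ_mult_left)

end

text \<open>Closure under divisors of monomials: the coefficients of a product at such exponents
  depend only on coefficients of the factors at such exponents.\<close>

definition down_closed :: "('v \<Rightarrow>\<^sub>0 nat) set \<Rightarrow> bool" where
  "down_closed S \<longleftrightarrow> (\<forall>a b. a + b \<in> S \<longrightarrow> a \<in> S \<and> b \<in> S)"

lemma down_closed_splittings:
  assumes "down_closed S" "m \<in> S" "p \<in> splittings m"
  shows "fst p \<in> S" "snd p \<in> S"
proof -
  have "fst p + snd p \<in> S" using assms(2,3) by (auto simp: splittings_def)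
  then show "fst p \<in> S" "snd p \<in> S" using assms(1) unfolding down_closed_def by blast+
qed

definition coeffs_in ::
  "('i \<Rightarrow> 'a) set \<Rightarrow> ('v \<Rightarrow>\<^sub>0 nat) set \<Rightarrow> ('i \<Rightarrow> ('v, 'a) mps) \<Rightarrow> bool" where
  "coeffs_in C S F \<longleftrightarrow> (\<forall>m\<in>S. (\<lambda>i. mps_nth (F i) m) \<in> C)"

context fun_subring
begin

lemma coeffs_const: "coeffs_in C S (\<lambda>_. f)"
  by (simp add: coeffs_in_def const)

lemma coeffs_diff: "coeffs_in C S F \<Longrightarrow> coeffs_in C S G \<Longrightarrow> coeffs_in C S (\<lambda>i. F i - G i)"
  using add[OF _ scaleQ[of _ "- 1"]]
  by (simp add: coeffs_in_def mps_nth_simps scaleQ_minus_left scaleQ_one)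

lemma coeffs_mult:
  assumes "down_closed S" "coeffs_in C S F" "coeffs_in C S G"
  shows "coeffs_in C S (\<lambda>i. F i * G i)"
  unfolding coeffs_in_def times_mps.rep_eq case_prod_unfold
  using assms(2,3) down_closed_splittings[OF assms(1)]
  by (intro ballI sum mult) (simp_all add: coeffs_in_def)

lemma coeffs_power:
  "down_closed S \<Longrightarrow> coeffs_in C S F \<Longrightarrow> coeffs_in C S (\<lambda>i. F i ^ n)"
  by (induction n) (simp_all add: coeffs_const coeffs_mult)

lemma coeffs_fps_eval:
  assumes "down_closed S" "coeffs_in C S F" "\<And>i. mps_nth (F i) 0 = 0"
  shows "coeffs_in C S (\<lambda>i. fps_eval f (F i))"
  unfolding coeffs_in_def
proof
  fix m assume "m \<in> S"
  then show "(\<lambda>i. mps_nth (fps_eval f (F i)) m) \<in> C"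
    unfolding fps_eval_nth[OF assms(3) order.refl]
    using coeffs_power[OF assms(1,2)] by (intro sum scaleQ) (simp add: coeffs_in_def)
qed

lemma coeffs_prod_list:
  "down_closed S \<Longrightarrow> (\<And>l. l \<in> set ls \<Longrightarrow> coeffs_in C S (F l)) \<Longrightarrow>
    coeffs_in C S (\<lambda>i. prod_list (map (\<lambda>l. F l i) ls))"
  by (induction ls) (simp_all add: coeffs_const coeffs_mult)

end

lemma coeffs_adams:
  fixes F :: "'i \<Rightarrow> ('v, 'r::{ring, monoid_mult}) mps" and C :: "('i \<Rightarrow> 'r ratext) set"
  assumes C: "fun_subring C" and S: "down_closed S" and l: "l \<ge> 1"
    and F: "coeffs_in C S (\<lambda>i. mps_map ratext_of (F i))"
  shows "coeffs_in C S (\<lambda>i. adams l (F i))"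
  unfolding coeffs_in_def
proof
  fix n assume n: "n \<in> S"
  interpret C: fun_subring C by (rule C)
  interpret mps_substitution "nscale l" "adams_sign l" by (rule mps_substitution_adams[OF l])
  have "m \<in> S" if "nscale l m = n" for m
  proof -
    have "m + nscale (l - 1) m = n"
      using that l by (simp flip: nscale_Suc)
    then have "m + nscale (l - 1) m \<in> S" using n by simp
    then show ?thesis using S unfolding down_closed_def by blast
  qed
  then show "(\<lambda>i. mps_nth (adams l (F i)) n) \<in> C"
    unfolding adams_def mps_nth_msub
    using F by (intro C.sum C.scaleQ) (auto simp: coeffs_in_def)
qed

text \<open>Each coefficient of \<open>Mseries\<close> arises through finitely many ring operations,
  rational scalings and maps \<open>T l\<close>, all of which stay within the given classes.\<close>

lemma coeffs_Mseries:
  fixes F :: "'i \<Rightarrow> ('v, 'r::{ring, monoid_mult}) mps"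
    and C :: "('i \<Rightarrow> 'r ratext) set" and C' :: "('i \<Rightarrow> 'r ginf) set"
  assumes C: "fun_subring C" and C': "fun_subring C'"
    and T: "\<And>l f. l \<ge> 1 \<Longrightarrow> f \<in> C \<Longrightarrow> (\<lambda>i. T l (f i)) \<in> C'"
    and S: "down_closed S"
    and F: "coeffs_in C S (\<lambda>i. mps_map ratext_of (F i))" and F0: "\<And>i. mps_nth (F i) 0 = 1"
  shows "coeffs_in C' S (\<lambda>i. Mseries (F i))"
proof -
  interpret C: fun_subring C by (rule C)
  interpret C': fun_subring C' by (rule C')
  have \<Theta>: "coeffs_in C' S (\<lambda>i. Theta l (adams l (F i)))" if l: "l \<ge> 1" for l
  proof -
    interpret lie_hom "T l" using l by (rule lie_hom_T)
    have A0: "mps_nth (adams l (F i)) 0 = 1" for i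
      by (simp only: adams_nth_0[OF l] F0 ratext_of_1)
    have "coeffs_in C S (\<lambda>i. mps_log (adams l (F i)))"
      unfolding mps_log_eq_fps_eval[OF A0]
      by (intro C.coeffs_fps_eval C.coeffs_diff C.coeffs_const coeffs_adams C S l F)
         (simp add: A0 mps_nth_simps)
    then have "coeffs_in C' S (\<lambda>i. mps_map (T l) (mps_log (adams l (F i))))"
      using T[OF l] by (simp add: coeffs_in_def mps_nth_map)
    moreover have X0: "mps_nth (mps_map (T l) (mps_log (adams l (F i)))) 0 = 0" for i
      by (simp add: mps_nth_map mps_log_nth_0 A0)
    ultimately show ?thesis
      unfolding Theta_def mps_exp_eq_fps_eval[OF X0] by (intro C'.coeffs_fps_eval S)
  qed
  show ?thesis
    unfolding coeffs_in_def
  proof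
    fix n assume n: "n \<in> S"
    have "coeffs_in C' S (\<lambda>i. prod_list (map (\<lambda>l. Theta l (adams l (F i))) [1..<Suc (mdeg n)]))"
      by (intro C'.coeffs_prod_list[where F = "\<lambda>l i. Theta l (adams l (F i))"] S \<Theta>) auto
    moreover have "mps_nth (Mseries (F i)) n
        = mps_nth (prod_list (map (\<lambda>l. Theta l (adams l (F i))) [1..<Suc (mdeg n)])) n" for i
      unfolding Mseries_def by (rule mps_nth_infprod[OF vanish_Theta_adams[OF F0] order.refl])
    ultimately show "(\<lambda>i. mps_nth (Mseries (F i)) n) \<in> C'"
      using n by (simp only: coeffs_in_def)
  qed
qed

text \<open>The coefficient at \<open>n\<close> depends only on the coefficients of the argument at
  divisors of x^n.\<close>

lemma Mseries_cong:
  fixes f g :: "('v, 'r::{ring, monoid_mult}) mps"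
  assumes f: "mps_nth f 0 = 1" and g: "mps_nth g 0 = 1"
    and eq: "\<And>a b. a + b = n \<Longrightarrow> mps_nth f a = mps_nth g a"
  shows "mps_nth (Mseries f) n = mps_nth (Mseries g) n"
proof -
  let ?S = "{a. \<exists>b. a + b = n}"
  \<comment> \<open>The two series form a family indexed by \<open>bool\<close>; membership in the
    class says that both members have the same coefficient.\<close>
  have "coeffs_in {h. h True = h False} ?S (\<lambda>i. Mseries (if i then f else g))"
  proof (rule coeffs_Mseries[where C = "{h. h True = h False}"])
    show "down_closed ?S"
      unfolding down_closed_def
    proof (intro allI impI)
      fix a b assume "a + b \<in> ?S"
      then obtain c where "a + b + c = n" by blast
      then have "a + (b + c) = n" "b + (a + c) = n" by (simp_all only: ac_simps)
      then show "a \<in> ?S \<and> b \<in> ?S" by blast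
    qed
    show "coeffs_in {h. h True = h False} ?S (\<lambda>i. mps_map ratext_of (if i then f else g))"
      using eq by (auto simp: coeffs_in_def mps_nth_map)
  qed (auto simp: fun_subring_def f g)
  moreover have "n \<in> ?S" by (auto intro: exI[of _ 0])
  ultimately show ?thesis by (simp add: coeffs_in_def)
qed

text \<open>Over a \<open>\<rat>\<close>-algebra these are the polynomial sequences of degree less than \<open>d\<close>.\<close>

primrec polydeg :: "nat \<Rightarrow> (nat \<Rightarrow> 'a::ab_group_add) \<Rightarrow> bool" where
  "polydeg 0 f \<longleftrightarrow> (\<forall>t. f t = 0)"
| "polydeg (Suc d) f \<longleftrightarrow> polydeg d (\<lambda>t. f (Suc t) - f t)"

lemma polydeg_zero: "polydeg d (\<lambda>_. 0)"
  by (induction d) simp_all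

lemma polydeg_const: "polydeg (Suc d) (\<lambda>_. a)"
  by (simp add: polydeg_zero)

lemma polydeg_add: "polydeg d f \<Longrightarrow> polydeg d g \<Longrightarrow> polydeg d (\<lambda>t. f t + g t)"
proof (induction d arbitrary: f g)
  case (Suc d)
  then have "polydeg d (\<lambda>t. (f (Suc t) - f t) + (g (Suc t) - g t))" by simp
  then show ?case by (simp add: algebra_simps)
qed simp

lemma polydeg_Suc: "polydeg d f \<Longrightarrow> polydeg (Suc d) f"
proof (induction d arbitrary: f)
  case (Suc d)
  then show ?case by simp
qed simp

lemma polydeg_mono: "d \<le> e \<Longrightarrow> polydeg d f \<Longrightarrow> polydeg e f"
  by (induction e rule: dec_induct) (simp_all only: polydeg_Suc)

lemma polydeg_shift: "polydeg d f \<Longrightarrow> polydeg d (\<lambda>t. f (Suc t))"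
  by (induction d arbitrary: f) simp_all

lemma polydeg_additive:
  assumes "\<And>x y. h (x + y) = h x + h y"
  shows "polydeg d f \<Longrightarrow> polydeg d (\<lambda>t. h (f t))"
proof (induction d arbitrary: f)
  case 0
  then show ?case using assms[of 0 0] by simp
next
  case (Suc d)
  have "h (x - y) = h x - h y" for x y
    using assms[of "x - y" y] by (simp add: eq_diff_eq)
  then show ?case using Suc.IH[of "\<lambda>t. f (Suc t) - f t"] Suc.prems by simp
qed

lemma polydeg_mult:
  fixes f g :: "nat \<Rightarrow> 'a::ring"
  shows "polydeg d f \<Longrightarrow> polydeg e g \<Longrightarrow> polydeg (d + e) (\<lambda>t. f t * g t)"
proof (induction "d + e" arbitrary: d e f g)
  case 0
  then show ?case by simp
next
  case (Suc n)
  show ?case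
  proof (cases "d = 0 \<or> e = 0")
    case True
    then have "(\<lambda>t. f t * g t) = (\<lambda>_. 0)" using Suc.prems by auto
    then show ?thesis by (simp only: polydeg_zero)
  next
    case False
    then obtain d' e' where de: "d = Suc d'" "e = Suc e'" by (metis not0_implies_Suc)
    \<comment> \<open>Discrete Leibniz rule: the difference of f g is (difference of f) times the
      shifted g, plus f times the difference of g.\<close>
    have "polydeg (d' + e) (\<lambda>t. (f (Suc t) - f t) * g (Suc t))"
      using Suc.prems Suc.hyps(2) by (intro Suc.hyps(1) polydeg_shift) (simp_all add: de)
    moreover have "polydeg (d + e') (\<lambda>t. f t * (g (Suc t) - g t))"
      using Suc.prems Suc.hyps(2) by (intro Suc.hyps(1)) (simp_all add: de)
    ultimately have "polydeg (d' + e)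
        (\<lambda>t. (f (Suc t) - f t) * g (Suc t) + f t * (g (Suc t) - g t))"
      by (intro polydeg_add) (simp_all add: de)
    then show ?thesis by (simp add: de algebra_simps)
  qed
qed

text \<open>f(0) is f(1) minus the difference at 0. The difference has lower degree and its values
  at positive arguments lie in \<open>G\<close>, so induction applies; no division occurs.\<close>

lemma polydeg_value_0:
  assumes "polydeg d f" and f: "\<And>t. f (Suc t) \<in> G"
    and G: "0 \<in> G" "\<And>x y. x \<in> G \<Longrightarrow> y \<in> G \<Longrightarrow> x - y \<in> G"
  shows "f 0 \<in> G"
  using assms(1) f
proof (induction d arbitrary: f)
  case (Suc d)
  have "f (Suc 0) - f 0 \<in> G"
    by (rule Suc.IH) (use Suc.prems G in auto)
  from G(2)[OF Suc.prems(2)[of 0] this] show ?case by simp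
qed (use G in simp)

lemma fun_subring_poly: "fun_subring {f. \<exists>d. polydeg d f}"
proof
  fix f g :: "nat \<Rightarrow> 'a"
  assume "f \<in> {f. \<exists>d. polydeg d f}" "g \<in> {f. \<exists>d. polydeg d f}"
  then obtain d e where de: "polydeg d f" "polydeg e g" by auto
  then have "polydeg (max d e) f" "polydeg (max d e) g" by (auto elim: polydeg_mono[rotated])
  then show "(\<lambda>i. f i + g i) \<in> {f. \<exists>d. polydeg d f}" by (blast intro: polydeg_add)
  show "(\<lambda>i. f i * g i) \<in> {f. \<exists>d. polydeg d f}" using de by (blast intro: polydeg_mult)
next
  fix a :: 'a
  show "(\<lambda>_. a) \<in> {f. \<exists>d. polydeg d f}" using polydeg_const[of 0 a] by blast
qed

text \<open>The coefficients of f + t g are affine in t, hence polynomial sequences, and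
  \<open>T l\<close> preserves these by additivity.\<close>

lemma polydeg_Mseries:
  fixes f g :: "('v, 'r::{ring, monoid_mult}) mps"
  assumes f: "mps_nth f 0 = 1" and g: "mps_nth g 0 = 0"
  shows "\<exists>d. polydeg d (\<lambda>t. mps_nth (Mseries (f + (\<Sum>i<t. g))) n)"
proof -
  have "coeffs_in {f. \<exists>d. polydeg d f} UNIV (\<lambda>t. Mseries (f + (\<Sum>i<t. g)))"
  proof (rule coeffs_Mseries[OF fun_subring_poly fun_subring_poly])
    fix l :: nat and h :: "nat \<Rightarrow> 'r ratext"
    assume l: "l \<ge> 1" and "h \<in> {f. \<exists>d. polydeg d f}"
    then obtain d where "polydeg d h" by auto
    from polydeg_additive[OF lie_hom.add[OF lie_hom_T[OF l]] this]
    show "(\<lambda>i. T l (h i)) \<in> {f. \<exists>d. polydeg d f}" by blast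
  next
    have "polydeg (Suc (Suc 0)) (\<lambda>t. ratext_of (mps_nth (f + (\<Sum>i<t. g)) m))" for m
      by (simp add: mps_nth_simps mps_nth_sum ratext_of_add)
    then show "coeffs_in {f. \<exists>d. polydeg d f} UNIV (\<lambda>t. mps_map ratext_of (f + (\<Sum>i<t. g)))"
      unfolding coeffs_in_def mps_nth_map by blast
  qed (simp_all add: down_closed_def mps_nth_simps mps_nth_sum f g)
  then show ?thesis by (simp add: coeffs_in_def)
qed

section \<open>Integrality\<close>

lemma finite_keys_mdeg_le:
  assumes S: "finite S"
  shows "finite {m :: 'v \<Rightarrow>\<^sub>0 nat. Poly_Mapping.keys m \<subseteq> S \<and> mdeg m \<le> D}"
proof -
  \<comment> \<open>Every exponent in question divides the monomial with exponent \<open>D\<close>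
    at each variable of \<open>S\<close>, and a monomial has finitely many divisors.\<close>
  define M :: "'v \<Rightarrow>\<^sub>0 nat" where "M = (\<Sum>v\<in>S. Poly_Mapping.single v D)"
  have M: "Poly_Mapping.lookup M v = (if v \<in> S then D else 0)" for v
    using S by (simp add: M_def lookup_sum lookup_single when_def)
  have "m \<in> fst ` splittings M" if m: "Poly_Mapping.keys m \<subseteq> S" "mdeg m \<le> D" for m
  proof -
    have "m + (M - m) = M"
    proof (rule poly_mapping_eqI)
      fix v
      have "Poly_Mapping.lookup m v \<le> Poly_Mapping.lookup M v"
        using lookup_le_mdeg[of m v] m by (auto simp: M in_keys_iff)
      then show "Poly_Mapping.lookup (m + (M - m)) v = Poly_Mapping.lookup M v"
        by (simp add: lookup_add lookup_minus)
    qed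
    then show ?thesis by (auto simp: splittings_def image_iff)
  qed
  then have "{m. Poly_Mapping.keys m \<subseteq> S \<and> mdeg m \<le> D} \<subseteq> fst ` splittings M" by blast
  then show ?thesis by (rule finite_subset) (simp add: finite_splittings)
qed

lemma mdeg_sum: "mdeg (\<Sum>x\<in>X. f x) = (\<Sum>x\<in>X. mdeg (f x))"
  by (induction X rule: infinite_finite_induct) simp_all

lemma mdeg_eq_sum:
  assumes "finite S" "Poly_Mapping.keys m \<subseteq> S"
  shows "mdeg m = (\<Sum>v\<in>S. Poly_Mapping.lookup m v)"
  unfolding mdeg_def
  by (rule Sum_any.expand_superset) (use assms in \<open>auto simp: in_keys_iff\<close>)

definition mono_subst :: "'v set \<Rightarrow> ('v \<Rightarrow> 'w \<Rightarrow>\<^sub>0 nat) \<Rightarrow> ('v \<Rightarrow>\<^sub>0 nat) \<Rightarrow> 'w \<Rightarrow>\<^sub>0 nat" where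
  "mono_subst S \<kappa> m = (\<Sum>v\<in>S. nscale (Poly_Mapping.lookup m v) (\<kappa> v))"

text \<open>Together with \<open>mono_subst\<close> this sends the variable v in \<open>S\<close> to
  x^(\<open>\<kappa> v\<close>) with sign (-1)^(\<open>mdeg (\<kappa> v)\<close>), and all other
  variables to 0.\<close>

definition mono_sign :: "'v set \<Rightarrow> ('v \<Rightarrow> 'w \<Rightarrow>\<^sub>0 nat) \<Rightarrow> ('v \<Rightarrow>\<^sub>0 nat) \<Rightarrow> rat" where
  "mono_sign S \<kappa> m = (if Poly_Mapping.keys m \<subseteq> S then (- 1) ^ mdeg (mono_subst S \<kappa> m) else 0)"

lemma mps_substitution_mono:
  fixes S :: "'v set" and \<kappa> :: "'v \<Rightarrow> 'w \<Rightarrow>\<^sub>0 nat"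
  assumes S: "finite S" and \<kappa>: "\<And>v. v \<in> S \<Longrightarrow> \<kappa> v \<noteq> 0"
  shows "mps_substitution (mono_subst S \<kappa>) (mono_sign S \<kappa>)"
proof
  show 0: "mono_subst S \<kappa> 0 = 0" by (simp add: mono_subst_def)
  then show "mono_sign S \<kappa> 0 = 1" by (simp add: mono_sign_def)
  fix a b :: "'v \<Rightarrow>\<^sub>0 nat"
  show add: "mono_subst S \<kappa> (a + b) = mono_subst S \<kappa> a + mono_subst S \<kappa> b"
    by (simp add: mono_subst_def lookup_add nscale_add_left sum.distrib)
  have "Poly_Mapping.keys (a + b) = Poly_Mapping.keys a \<union> Poly_Mapping.keys b"
    by (auto simp: in_keys_iff lookup_add)
  then show "mono_sign S \<kappa> (a + b) = mono_sign S \<kappa> a * mono_sign S \<kappa> b"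
    by (simp add: mono_sign_def add power_add)
next
  have deg: "mdeg m \<le> mdeg (mono_subst S \<kappa> m)" if "Poly_Mapping.keys m \<subseteq> S" for m
    unfolding mdeg_eq_sum[OF S that] mono_subst_def mdeg_sum
  proof (rule sum_mono)
    fix v assume "v \<in> S"
    then have "mdeg (\<kappa> v) \<noteq> 0" using \<kappa> by simp
    then show "Poly_Mapping.lookup m v \<le> mdeg (nscale (Poly_Mapping.lookup m v) (\<kappa> v))"
      by (cases "mdeg (\<kappa> v)") simp_all
  qed
  show "mdeg m \<le> mdeg (mono_subst S \<kappa> m)" if "mono_sign S \<kappa> m \<noteq> 0" for m
    using that deg by (simp add: mono_sign_def split: if_splits)
  show "finite {m. mono_sign S \<kappa> m \<noteq> 0 \<and> mono_subst S \<kappa> m = n}" for n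
    by (rule finite_subset[OF _ finite_keys_mdeg_le[OF S, of "mdeg n"]])
       (use deg in \<open>auto simp: mono_sign_def split: if_splits\<close>)
qed

lemma (in mps_substitution) msub_cong:
  "(\<And>m. \<chi> m \<noteq> 0 \<Longrightarrow> mps_nth f m = mps_nth g m) \<Longrightarrow> msub f = msub g"
  by (rule mps_eqI) (auto simp: mps_nth_msub intro: sum.cong)

lemma (in mps_substitution) msub_finite_sum: "msub (\<Sum>x\<in>X. f x) = (\<Sum>x\<in>X. msub (f x))"
  by (rule mps_eqI) (simp add: mps_nth_msub mps_nth_sum scaleQ_sum_right, rule sum.swap)

text \<open>Once the variables outside \<open>S\<close> are set to 0, each power sum keeps only the
  l-th powers of the variables in \<open>S\<close>.\<close>

lemma basis_series_nth:
  assumes S: "finite S" "fst ` S \<subseteq> B" and l: "l \<ge> 1" and m: "Poly_Mapping.keys m \<subseteq> S"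
  shows "mps_nth (basis_series B l) m
    = mps_nth (1 + (\<Sum>v\<in>S. mps_monom (Poly_Mapping.single v l) (ratext_of (fst v)))) m"
proof -
  have "(\<Sum>U | U \<in> B \<and> mps_nth (psum U l) m \<noteq> 0. zscale (mps_nth (psum U l) m) (ratext_of U))
      = (\<Sum>v\<in>S. if m = Poly_Mapping.single v l then ratext_of (fst v) else 0)"
  proof (cases "\<exists>v. m = Poly_Mapping.single v l")
    case True
    then obtain U i where m': "m = Poly_Mapping.single (U, i) l" by auto
    have inj: "Poly_Mapping.single w l = Poly_Mapping.single w' l \<longleftrightarrow> w = w'" for w w' :: "'a \<times> nat"
    proof
      assume "Poly_Mapping.single w l = Poly_Mapping.single w' l"
      then have "Poly_Mapping.lookup (Poly_Mapping.single w l) w = Poly_Mapping.lookup (Poly_Mapping.single w' l) w"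
        by simp
      then show "w = w'" using l by (simp add: lookup_single when_def split: if_splits)
    qed simp
    have U: "(U, i) \<in> S" using m l by (simp add: m')
    then have "{U'. U' \<in> B \<and> mps_nth (psum U' l) m \<noteq> 0} = {U}"
      using S by (auto simp: psum_def m' inj)
    moreover have "mps_nth (psum U l) m = 1" by (auto simp: psum_def m')
    ultimately show ?thesis using U S by (simp add: m' inj)
  next
    case False
    then show ?thesis by (auto simp: psum_def intro!: sum.neutral)
  qed
  then show ?thesis by (simp add: basis_series_def mps_nth_simps mps_nth_sum mps_nth_monom)
qed

lemma vanish_basis_series: "vanish l (basis_series B l - 1)"
  by (auto simp: vanish_def basis_series_def mps_nth_simps psum_def intro!: sum.neutral)

lemma map_ratext_of_one_plus_sum:
  "mps_map ratext_of (1 + (\<Sum>v\<in>S. mps_monom (\<kappa> v) (u v)))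
    = 1 + (\<Sum>v\<in>S. mps_monom (\<kappa> v) (ratext_of (u v)))"
  by (rule mps_eqI)
     (auto simp: mps_nth_map mps_nth_simps mps_nth_sum mps_nth_monom ratext_of_add ratext_of_sum
        ratext_of_0 ratext_of_1 intro!: sum.cong)

text \<open>The signed substitution carries the l-th power of the variable v to exactly the monomial
  that \<open>adams l\<close> makes of x^(\<open>\<kappa> v\<close>). Indices (U, i) let one basis
  element occur with several monomials.\<close>

lemma Mseries_positive:
  fixes \<kappa> :: "'r::{ring, monoid_mult} \<times> nat \<Rightarrow> 'w \<Rightarrow>\<^sub>0 nat"
  assumes S: "finite S" "fst ` S \<subseteq> B" and \<kappa>: "\<And>v. v \<in> S \<Longrightarrow> \<kappa> v \<noteq> 0"
  shows "Mseries (1 + (\<Sum>v\<in>S. mps_monom (\<kappa> v) (fst v)))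
    = mps_substitution.msub (mono_subst S \<kappa>) (mono_sign S \<kappa>)
        (mps_infprod (\<lambda>l. Theta l (basis_series B l)))"
proof -
  interpret mps_substitution "mono_subst S \<kappa>" "mono_sign S \<kappa>"
    by (rule mps_substitution_mono[OF S(1) \<kappa>])
  have v: "mono_subst S \<kappa> (Poly_Mapping.single v l) = nscale l (\<kappa> v)" if "v \<in> S" for v l
  proof -
    have "mono_subst S \<kappa> (Poly_Mapping.single v l) = (\<Sum>w\<in>S. if w = v then nscale l (\<kappa> v) else 0)"
      unfolding mono_subst_def by (intro sum.cong) (auto simp: lookup_single when_def)
    then show ?thesis using S that by simp
  qed
  have sub: "msub (basis_series B l) = adams l (1 + (\<Sum>v\<in>S. mps_monom (\<kappa> v) (fst v)))"
    if l: "l \<ge> 1" for l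
  proof -
    interpret A: mps_substitution "nscale l" "adams_sign l" by (rule mps_substitution_adams[OF l])
    have "msub (basis_series B l)
        = msub (1 + (\<Sum>v\<in>S. mps_monom (Poly_Mapping.single v l) (ratext_of (fst v))))"
      using basis_series_nth[OF S l] by (intro msub_cong) (simp add: mono_sign_def split: if_splits)
    also have "\<dots> = 1 + (\<Sum>v\<in>S. mps_monom (nscale l (\<kappa> v)) (adams_sign l (\<kappa> v) *\<^sub>Q ratext_of (fst v)))"
      unfolding msub_add msub_1 msub_finite_sum msub_monom
      by (intro arg_cong2[of _ _ _ _ "(+)"] refl sum.cong) (simp add: mono_sign_def v)
    also have "\<dots> = adams l (1 + (\<Sum>v\<in>S. mps_monom (\<kappa> v) (fst v)))"
      by (simp add: adams_def map_ratext_of_one_plus_sum A.msub_add A.msub_1 A.msub_finite_sum A.msub_monom)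
    finally show ?thesis .
  qed
  have "msub (mps_infprod (\<lambda>l. Theta l (basis_series B l)))
      = mps_infprod (\<lambda>l. msub (Theta l (basis_series B l)))"
    by (rule msub_infprod) (rule vanish_Theta[OF vanish_basis_series])
  also have "\<dots> = Mseries (1 + (\<Sum>v\<in>S. mps_monom (\<kappa> v) (fst v)))"
    unfolding Mseries_def
    by (intro mps_infprod_cong)
       (simp only: msub_Theta nth_0_of_vanish[OF vanish_basis_series] sub)
  finally show ?thesis by simp
qed

section \<open>Membership of coefficients in the integral form\<close>

context
  fixes B :: "'r::{ring, monoid_mult} set" and Z :: "('r \<Rightarrow> nat list) \<Rightarrow> 'r ginf"
  assumes Z: "is_Z_family B Z"
begin

lemma mps_nth_infprod_basis_series_in_G_int:
  "mps_nth (mps_infprod (\<lambda>l. Theta l (basis_series B l))) m \<in> G_int B Z"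
  unfolding Z[unfolded is_Z_family_def, symmetric] mps_nth_Abs G_int_def
  by (intro zmod.span_sum zmod.span_scale zmod.span_base) auto

lemma Mseries_positive_in_G_int:
  fixes \<kappa> :: "'r \<times> nat \<Rightarrow> 'w \<Rightarrow>\<^sub>0 nat"
  assumes S: "finite S" "fst ` S \<subseteq> B" and \<kappa>: "\<And>v. v \<in> S \<Longrightarrow> \<kappa> v \<noteq> 0"
  shows "mps_nth (Mseries (1 + (\<Sum>v\<in>S. mps_monom (\<kappa> v) (fst v)))) n \<in> G_int B Z"
proof -
  interpret mps_substitution "mono_subst S \<kappa>" "mono_sign S \<kappa>"
    by (rule mps_substitution_mono[OF S(1) \<kappa>])
  have mem: "mono_sign S \<kappa> m *\<^sub>Q x \<in> G_int B Z" if "x \<in> G_int B Z" for m x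
  proof -
    \<comment> \<open>A span over the integers is not closed under rational scalars, but it is under
      the only weights that occur.\<close>
    have "mono_sign S \<kappa> m \<in> {0, 1, - 1}"
      by (cases "even (mdeg (mono_subst S \<kappa> m))") (simp_all add: mono_sign_def)
    then show ?thesis
      using that by (auto simp: G_int_def scaleQ_one scaleQ_minus_left zmod.span_zero zmod.span_neg)
  qed
  have eq: "Mseries (1 + (\<Sum>v\<in>S. mps_monom (\<kappa> v) (fst v)))
      = msub (mps_infprod (\<lambda>l. Theta l (basis_series B l)))"
    by (rule Mseries_positive[OF S \<kappa>])
  show ?thesis
    unfolding eq mps_nth_msub G_int_def
    by (rule zmod.span_sum)
       (rule mem[OF mps_nth_infprod_basis_series_in_G_int, unfolded G_int_def])
qed

text \<open>Finite sums of nonconstant monomials with coefficients in the basis; repetitions encode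
  positive multiplicities.\<close>

inductive pos_sum :: "('w, 'r) mps \<Rightarrow> bool" where
  zero: "pos_sum 0"
| add: "pos_sum f \<Longrightarrow> k \<noteq> 0 \<Longrightarrow> U \<in> B \<Longrightarrow> pos_sum (f + mps_monom k U)"

lemma pos_sum_nth_0: "pos_sum f \<Longrightarrow> mps_nth f 0 = 0"
  by (induction rule: pos_sum.induct) (simp_all add: mps_nth_simps mps_nth_monom)

lemma pos_sum_add: "pos_sum g \<Longrightarrow> pos_sum f \<Longrightarrow> pos_sum (f + g)"
  by (induction rule: pos_sum.induct) (simp_all add: pos_sum.add flip: add.assoc)

lemma pos_sum_indexed:
  fixes f :: "('w, 'r) mps"
  assumes "pos_sum f"
  shows "\<exists>S (\<kappa> :: 'r \<times> nat \<Rightarrow> 'w \<Rightarrow>\<^sub>0 nat). finite S \<and> fst ` S \<subseteq> B \<and> (\<forall>v\<in>S. \<kappa> v \<noteq> 0) \<and>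
    f = (\<Sum>v\<in>S. mps_monom (\<kappa> v) (fst v))"
  using assms
proof induction
  case zero
  show ?case by (rule exI[of _ "{}"]) simp
next
  case (add f k U)
  then obtain S and \<kappa> :: "'r \<times> nat \<Rightarrow> 'w \<Rightarrow>\<^sub>0 nat"
    where S: "finite S" "fst ` S \<subseteq> B" "\<forall>v\<in>S. \<kappa> v \<noteq> 0" "f = (\<Sum>v\<in>S. mps_monom (\<kappa> v) (fst v))"
    by blast
  \<comment> \<open>The first component of the index must be \<open>U\<close>, so a repeated basis
    element is separated by a fresh second component.\<close>
  obtain i where i: "i \<notin> snd ` S" using S(1) ex_new_if_finite[of "snd ` S"] by auto
  then have new: "(U, i) \<notin> S" by force
  have "f + mps_monom k U
      = (\<Sum>v\<in>insert (U, i) S. mps_monom ((\<kappa>((U, i) := k)) v) (fst v))"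
    using S(1) new by (auto simp: S(4) add.commute intro!: sum.cong)
  then show ?case
    using S add.hyps by (intro exI[of _ "insert (U, i) S"] exI[of _ "\<kappa>((U, i) := k)"]) auto
qed

text \<open>Negative terms are removed one at a time: adding copies of the subtracted monomial gives
  a polynomial dependence on their number.\<close>

lemma Mseries_pos_sum_diff:
  fixes f g :: "('w, 'r) mps"
  assumes "pos_sum g" "pos_sum f"
  shows "mps_nth (Mseries (1 + f - g)) n \<in> G_int B Z"
  using assms
proof (induction arbitrary: f)
  case zero
  from pos_sum_indexed[OF this] show ?case
    by (auto intro: Mseries_positive_in_G_int)
next
  case (add g k U)
  \<comment> \<open>For \<open>Suc t\<close> one copy cancels the subtracted monomial and the other
    t copies join \<open>f\<close>, so the induction hypothesis applies. The value at 0 is the one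
    sought.\<close>
  let ?F = "\<lambda>t. mps_nth (Mseries (1 + f - (g + mps_monom k U) + (\<Sum>i<(t :: nat). mps_monom k U))) n"
  obtain d where d: "polydeg d ?F"
    using add.hyps add.prems polydeg_Mseries[of "1 + f - (g + mps_monom k U)" "mps_monom k U"]
    by (auto simp: mps_nth_simps mps_nth_monom pos_sum_nth_0)
  have F:  "?F (Suc t) \<in> G_int B Z" for t
  proof -
    have "pos_sum (f + (\<Sum>i<t. mps_monom k U))"
      using add.hyps add.prems by (induction t) (simp_all add: pos_sum.add flip: add.assoc)
    from add.IH[OF this] show ?thesis by (simp add: algebra_simps)
  qed
  have "?F 0 \<in> G_int B Z"
    by (rule polydeg_value_0[OF d F]) (simp_all add: G_int_def zmod.span_zero zmod.span_diff)
  then show ?case by simp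
qed

definition pos_diff :: "('w, 'r) mps \<Rightarrow> bool" where
  "pos_diff h \<longleftrightarrow> (\<exists>f g. pos_sum f \<and> pos_sum g \<and> h = f - g)"

lemma pos_diff_add: "pos_diff h \<Longrightarrow> pos_diff h' \<Longrightarrow> pos_diff (h + h')"
  unfolding pos_diff_def by (metis add_diff_add pos_sum_add)

lemma pos_diff_0: "pos_diff 0"
  unfolding pos_diff_def by (metis diff_zero pos_sum.zero)

lemma pos_diff_uminus: "pos_diff h \<Longrightarrow> pos_diff (- h)"
  unfolding pos_diff_def by (metis minus_diff_eq)

lemma pos_diff_sum: "(\<And>x. x \<in> X \<Longrightarrow> pos_diff (f x)) \<Longrightarrow> pos_diff (\<Sum>x\<in>X. f x)"
  by (induction X rule: infinite_finite_induct) (auto simp: pos_diff_0 pos_diff_add)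

lemma pos_diff_monom:
  assumes k: "k \<noteq> 0" and r: "r \<in> zspan B"
  shows "pos_diff (mps_monom k r)"
  using r
proof (induction rule: zmod.span_induct_alt)
  case base
  have "mps_monom k 0 = (0 :: ('a, 'r) mps)" by (rule mps_eqI) (simp add: mps_nth_monom zero_mps.rep_eq)
  then show ?case by (simp add: pos_diff_0)
next
  case (step c x y)
  have "pos_sum (mps_monom k x)"
    using pos_sum.add[OF pos_sum.zero k step(1)] by simp
  then have x: "pos_diff (mps_monom k x)"
    unfolding pos_diff_def by (metis diff_zero pos_sum.zero)
  have eq: "mps_monom k (zscale c x + y)
      = (\<Sum>i<nat c. mps_monom k x) + - (\<Sum>i<nat (- c). mps_monom k x) + mps_monom k y"
    by (rule mps_eqI) (simp add: zscale_def mps_nth_simps mps_nth_sum mps_nth_monom)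
  show ?case
    unfolding eq by (intro pos_diff_add pos_diff_uminus pos_diff_sum x step)
qed

lemma Mseries_in_G_int:
  fixes f :: "('w, 'r) mps"
  assumes B: "zspan B = UNIV" and f: "mps_nth f 0 = 1"
  shows "Mseries f \<in> mps_over (G_int B Z)"
proof -
  have "mps_nth (Mseries f) n \<in> G_int B Z" for n
  proof -
    \<comment> \<open>The series \<open>f\<close> may be infinite, but only the divisors of x^n
      matter; the exponent 0 is left out because the constant term 1 is treated separately.\<close>
    define K where "K = fst ` splittings n - {0}"
    have K: "finite K" by (simp add: K_def finite_splittings)
    define h where "h = (\<Sum>k\<in>K. mps_monom k (mps_nth f k))"
    have "pos_diff h"
      unfolding h_def by (intro pos_diff_sum pos_diff_monom) (auto simp: K_def B)
    then obtain p q where pq: "pos_sum p" "pos_sum q" "h = p - q"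
      by (auto simp: pos_diff_def)
    have h: "mps_nth h a = (if a \<in> K then mps_nth f a else 0)" for a
      using K by (simp add: h_def mps_nth_sum mps_nth_monom)
    have "mps_nth (Mseries f) n = mps_nth (Mseries (1 + p - q)) n"
    proof (rule Mseries_cong[OF f])
      show "mps_nth (1 + p - q) 0 = 1"
        using pq by (simp add: mps_nth_simps pos_sum_nth_0)
      fix a b assume "a + b = n"
      then have "a = 0 \<or> a \<in> K" by (force simp: K_def splittings_def image_iff)
      moreover have "0 \<notin> K" by (simp add: K_def)
      ultimately have "mps_nth f a = mps_nth (1 + h) a"
        by (auto simp: mps_nth_simps h f)
      then show "mps_nth f a = mps_nth (1 + p - q) a" by (simp add: pq(3) add_diff_eq)
    qed
    then show ?thesis using Mseries_pos_sum_diff[OF pq(2,1)] by simp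
  qed
  then show ?thesis by (simp add: mps_over_def)
qed

end

section \<open>The commutation identity with its integrality\<close>

theorem theorem5p4:
  fixes U V :: "'r::{ring, monoid_mult}" and B :: "'r set"
  assumes "is_zbasis B"
  shows
    "mps_subst (Eseries U) u_var * mps_inverse (mps_subst (Eseries (V * U)) (- (u_var * v_var)))
        * mps_subst (Eseries V) v_var
      = mps_subst (Eseries V) v_var * mps_inverse (mps_subst (Eseries (U * V)) (- (u_var * v_var)))
        * mps_subst (Eseries U) u_var
     \<and> (\<forall>Z. is_Z_family B Z \<longrightarrow>
          {mps_subst (Eseries U) u_var, mps_subst (Eseries V) v_var,
           mps_subst (Eseries (V * U)) (- (u_var * v_var)),
           mps_subst (Eseries (U * V)) (- (u_var * v_var)),
           mps_inverse (mps_subst (Eseries (V * U)) (- (u_var * v_var))),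
           mps_inverse (mps_subst (Eseries (U * V)) (- (u_var * v_var))),
           mps_subst (Eseries U) u_var
             * mps_inverse (mps_subst (Eseries (V * U)) (- (u_var * v_var)))
             * mps_subst (Eseries V) v_var}
          \<subseteq> mps_over (G_int B Z))"
proof -
  let ?u = "Poly_Mapping.single Var_u 1 :: uv \<Rightarrow>\<^sub>0 nat" and ?v = "Poly_Mapping.single Var_v 1 :: uv \<Rightarrow>\<^sub>0 nat"
  define a where "a = mps_monom ?u U"
  define b where "b = mps_monom ?v V"
  have nz: "?u \<noteq> 0" "?v \<noteq> 0" "?u + ?v \<noteq> 0"
    using mdeg_single[of Var_u 1] mdeg_single[of Var_v 1] mdeg_add[of ?u ?v] by (metis mdeg_zero one_neq_zero add_is_0)+
  \<comment> \<open>A monomial of degree 2 with coefficient -1, as the sign condition of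
    \<open>mps_subst_Eseries\<close> demands.\<close>
  have uv: "- (u_var * v_var) = mps_monom (?u + ?v) (- 1)"
    by (rule mps_eqI) (simp add: mps_var_def mps_monom_mult mps_nth_simps mps_nth_monom)
  have E: "mps_subst (Eseries U) u_var = Mseries (1 - a)" "mps_subst (Eseries V) v_var = Mseries (1 - b)"
    unfolding mps_var_def a_def b_def by (intro mps_subst_Eseries nz; simp)+
  have "mps_subst (Eseries W) (- (u_var * v_var)) = Mseries (1 - mps_monom (?u + ?v) W)" for W :: 'r
    unfolding uv by (intro mps_subst_Eseries nz) simp
  then have E': "mps_subst (Eseries (V * U)) (- (u_var * v_var)) = Mseries (1 - b * a)"
      "mps_subst (Eseries (U * V)) (- (u_var * v_var)) = Mseries (1 - a * b)"
    by (simp_all add: a_def b_def mps_monom_mult add.commute)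
  have ab: "mps_nth a 0 = 0" "mps_nth b 0 = 0"
    using nz by (simp_all add: a_def b_def mps_nth_monom)
  then have 1: "mps_nth (1 - a) 0 = 1" "mps_nth (1 - b) 0 = 1" "mps_nth (1 - b * a) 0 = 1" "mps_nth (1 - a * b) 0 = 1"
    by (simp_all add: minus_mps.rep_eq one_mps.rep_eq)
  \<comment> \<open>Inverses are turned into values of \<open>Mseries\<close>, so that both sides of
    the identity become \<open>Mseries\<close> of one series over \<open>R\<close>.\<close>
  note I = mps_inverse_Mseries[OF 1(3)] mps_inverse_Mseries[OF 1(4)]
  have prod: "Mseries (1 - a) * Mseries (mps_geom (1 - b * a)) * Mseries (1 - b)
      = Mseries ((1 - a) * mps_geom (1 - b * a) * (1 - b))"
    by (simp add: Mseries_mult 1 mps_geom_nth_0)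
  have "Mseries (1 - b) * Mseries (mps_geom (1 - a * b)) * Mseries (1 - a)
      = Mseries ((1 - b) * mps_geom (1 - a * b) * (1 - a))"
    by (simp add: Mseries_mult 1 mps_geom_nth_0)
  also have "(1 - b) * mps_geom (1 - a * b) * (1 - a) = (1 - a) * mps_geom (1 - b * a) * (1 - b)"
    by (rule inverse_identity[symmetric, OF mps_geom[OF 1(1)] mps_geom[OF 1(2)]])
       (rule mps_geom_mult[OF 1(3)] mps_mult_geom[OF 1(4)])+
  finally have eq: "Mseries (1 - a) * Mseries (mps_geom (1 - b * a)) * Mseries (1 - b)
      = Mseries (1 - b) * Mseries (mps_geom (1 - a * b)) * Mseries (1 - a)"
    using prod by simp
  have B: "zspan B = UNIV" using assms by (simp add: is_zbasis_def)
  have int: "Mseries f \<in> mps_over (G_int B Z)"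
    if "is_Z_family B Z" "mps_nth f 0 = 1" for Z and f :: "(uv, 'r) mps"
    by (rule Mseries_in_G_int[OF that(1) B that(2)])
  show ?thesis
    unfolding E E' I
  proof (intro conjI allI impI)
    fix Z assume Z: "is_Z_family B Z"
    show "{Mseries (1 - a), Mseries (1 - b), Mseries (1 - b * a), Mseries (1 - a * b),
        Mseries (mps_geom (1 - b * a)), Mseries (mps_geom (1 - a * b)),
        Mseries (1 - a) * Mseries (mps_geom (1 - b * a)) * Mseries (1 - b)} \<subseteq> mps_over (G_int B Z)"
      \<comment> \<open>By \<open>prod\<close> the whole product is itself a value of
        \<open>Mseries\<close>, so \<open>int\<close> covers it in the same way as the other
        members.\<close>
      unfolding prod using int[OF Z] 1 by (simp add: mps_geom_nth_0)
  qed (rule eq)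
qed

end
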